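(* The semigroup $S$ associated with the Grušin operator satisfies $S_t1\hspace{-4.5pt}1=1\hspace{-4.5pt}1$ on $L_\infty({\bf R}^n\times{\bf R}^m)$ for all $t>0$. Hence the kernel satisfies \[ \int_{{\bf R}^n\times{\bf R}^m}dy\,K_t(x\,;y)=1 \] for all $t>0$ and almost all $x\in{\bf R}^{n+m}$.
   Context: The Grušin operator $H$ is the positive self-adjoint operator associated with the closure of $h(\varphi)=\sum_{i,j}(\partial_i\varphi,c_{ij}\partial_j\varphi)$ on $L_2({\bf R}^n\times{\bf R}^m)$, where $C=(c_{ij})$ is real symmetric measurable, positive-definite a.e., $C\sim C_\delta$ with $C_\delta(x_1,x_2)=c_{\delta_1,\delta_1'}(x_1)\,I_n+c_{\delta_2,\delta_2'}(x_1)\,I_m$, $c_{\delta_i,\delta_i'}(x)\sim|x|^{(2\delta_i,2\delta_i')}$ ($a^{(\alpha,\alpha')}=a^\alpha$ for $a\le1$, $a^{\alpha'}$ for $a\ge1$), $\delta_1,\delta_1'\in[0,1\rangle$, $\delta_2,\delta_2'\ge0$. $S_t=e^{-tH}$ is submarkovian (extends to $L_\infty$) and $K_t$ is its non-negative integral kernel; $1\hspace{-4.5pt}1$ is the constant function one. *)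

theory Defs
  imports "HOL-Analysis.Analysis"
begin

(* Points of R^n x R^m are represented as vectors  x :: real^('n + 'm);
   the first block of coordinates (indices Inl i) is x1 \<in> R^n,
   the second block (indices Inr j) is x2 \<in> R^m. *)

definition fst_part :: "real^('n::finite + 'm::finite) \<Rightarrow> real^'n" where
  "fst_part x = (\<chi> i. x $ Inl i)"

definition snd_part :: "real^('n::finite + 'm::finite) \<Rightarrow> real^'m" where
  "snd_part x = (\<chi> j. x $ Inr j)"

definition pow2 :: "real \<Rightarrow> real \<Rightarrow> real \<Rightarrow> real" where
  "pow2 a \<alpha> \<alpha>' = (if a \<le> 1 then a powr \<alpha> else a powr \<alpha>')"

coinductive smooth :: "('a::euclidean_space \<Rightarrow> real) \<Rightarrow> bool" where
  "(\<forall>x. f differentiable (at x)) \<Longrightarrow>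
   (\<forall>b\<in>Basis. smooth (\<lambda>x. frechet_derivative f (at x) b)) \<Longrightarrow> smooth f"

definition Cc_inf :: "('a::euclidean_space \<Rightarrow> real) set" where
  "Cc_inf = {f. smooth f \<and> compact (closure {x. f x \<noteq> 0})}"

definition partial :: "'k::finite \<Rightarrow> (real^'k \<Rightarrow> real) \<Rightarrow> real^'k \<Rightarrow> real" where
  "partial k f x = frechet_derivative f (at x) (axis k 1)"

(* the real Hilbert space L_2(R^n x R^m) (functions, identified a.e.) *)
definition L2 :: "(real^'k::finite \<Rightarrow> real) set" where
  "L2 = {f. f \<in> borel_measurable lborel \<and> integrable lborel (\<lambda>x. (f x)^2)}"

definition L2_dist2 :: "(real^'k::finite \<Rightarrow> real) \<Rightarrow> (real^'k \<Rightarrow> real) \<Rightarrow> real" where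
  "L2_dist2 f g = (\<integral>x. (f x - g x)^2 \<partial>lborel)"

definition L2_inner :: "(real^'k::finite \<Rightarrow> real) \<Rightarrow> (real^'k \<Rightarrow> real) \<Rightarrow> real" where
  "L2_inner f g = (\<integral>x. f x * g x \<partial>lborel)"

definition hform :: "(real^'k::finite \<Rightarrow> real^'k^'k) \<Rightarrow> (real^'k \<Rightarrow> real) \<Rightarrow> real" where
  "hform C \<phi> = (\<integral>x. (\<Sum>i\<in>UNIV. \<Sum>j\<in>UNIV. partial i \<phi> x * (C x $ i $ j) * partial j \<phi> x) \<partial>lborel)"

definition approx_seq :: "(real^'k::finite \<Rightarrow> real^'k^'k) \<Rightarrow> (nat \<Rightarrow> real^'k \<Rightarrow> real)
    \<Rightarrow> (real^'k \<Rightarrow> real) \<Rightarrow> bool" where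
  "approx_seq C \<phi> u \<longleftrightarrow> (\<forall>k. \<phi> k \<in> Cc_inf) \<and>
     (\<lambda>k. L2_dist2 (\<phi> k) u) \<longlonglongrightarrow> 0 \<and>
     (\<forall>e>0. \<exists>N. \<forall>k\<ge>N. \<forall>l\<ge>N. hform C (\<lambda>x. \<phi> k x - \<phi> l x) < e)"

definition hdom :: "(real^'k::finite \<Rightarrow> real^'k^'k) \<Rightarrow> (real^'k \<Rightarrow> real) set" where
  "hdom C = {u. u \<in> L2 \<and> (\<exists>\<phi>. approx_seq C \<phi> u)}"

definition hbar :: "(real^'k::finite \<Rightarrow> real^'k^'k) \<Rightarrow> (real^'k \<Rightarrow> real) \<Rightarrow> real" where
  "hbar C u = lim (\<lambda>k. hform C ((SOME \<phi>. approx_seq C \<phi> u) k))"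

definition hbar2 :: "(real^'k::finite \<Rightarrow> real^'k^'k) \<Rightarrow> (real^'k \<Rightarrow> real) \<Rightarrow> (real^'k \<Rightarrow> real) \<Rightarrow> real" where
  "hbar2 C u v = (hbar C (\<lambda>x. u x + v x) - hbar C (\<lambda>x. u x - v x)) / 4"

(* graph of the self-adjoint operator H associated with the closed form:
   u \<in> D(H) and H u = f  iff  u \<in> D(hbar), f \<in> L2 and hbar(u,v) = (f,v) for all v \<in> D(hbar) *)
definition H_graph :: "(real^'k::finite \<Rightarrow> real^'k^'k) \<Rightarrow> (real^'k \<Rightarrow> real) \<Rightarrow> (real^'k \<Rightarrow> real) \<Rightarrow> bool" where
  "H_graph C u f \<longleftrightarrow> u \<in> hdom C \<and> f \<in> L2 \<and> (\<forall>v\<in>hdom C. hbar2 C u v = L2_inner f v)"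

(* S is the semigroup S_t = e^{-tH} on L2: for each initial datum u0 \<in> L2, t \<mapsto> S t u0
   is the (unique) solution of u' = -H u, u(0) = u0, continuous on [0,\<infinity>) and
   differentiable in L2 for t > 0. *)
definition is_semigroup_of :: "(real^'k::finite \<Rightarrow> real^'k^'k) \<Rightarrow>
    (real \<Rightarrow> (real^'k \<Rightarrow> real) \<Rightarrow> (real^'k \<Rightarrow> real)) \<Rightarrow> bool" where
  "is_semigroup_of C S \<longleftrightarrow> (\<forall>u0\<in>L2.
     (\<forall>t\<ge>0. S t u0 \<in> L2) \<and>
     L2_dist2 (S 0 u0) u0 = 0 \<and>
     (\<forall>t\<ge>0. ((\<lambda>s. L2_dist2 (S s u0) (S t u0)) \<longlongrightarrow> 0) (at t within {0..})) \<and>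
     (\<forall>t>0. \<exists>f. H_graph C (S t u0) f \<and>
        ((\<lambda>s. L2_dist2 (\<lambda>x. (S (t + s) u0 x - S t u0 x) / s) (\<lambda>x. - f x)) \<longlongrightarrow> 0) (at 0)))"

end

theory Submission
  imports Defs "HOL-Computational_Algebra.Polynomial" "HOL-Probability.Sinc_Integral"
begin

text \<open>
  Write \<open>\<Gamma>(f, g) = \<nabla>f \<cdot> C \<nabla>g\<close>. With \<open>\<kappa>\<close> a large integer, the polynomial
  \<open>P(x) = (1 + |x\<^sub>1|\<^sup>2)\<^sup>\<kappa> + |x\<^sub>2|\<^sup>2\<close> satisfies \<open>\<Gamma>(P, P) \<le> c P\<^sup>2\<close>, so that the integrable weight
  \<open>\<sigma> = P\<^sup>-\<^sup>q\<close> satisfies \<open>\<Gamma>(\<sigma>, \<sigma>) \<le> c' \<sigma>\<^sup>2\<close>, while the compactly supported cutoffs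
  \<open>g\<^sub>k = exp (1 - 1 / (1 - P / k))\<close> increase to 1 with \<open>\<eta>\<^sub>k = \<integral> \<sigma> \<Gamma>(g\<^sub>k, g\<^sub>k) = O(k\<^sup>-\<^sup>2)\<close>.
  For \<open>z = S\<^sub>t g\<^sub>k - g\<^sub>k\<close> the derivative of \<open>\<integral> \<sigma> z\<^sup>2\<close> is \<open>-2 h(S\<^sub>t g\<^sub>k, \<sigma> z)\<close>, which is at most
  \<open>4 c' \<integral> \<sigma> z\<^sup>2 + 4 \<eta>\<^sub>k\<close>. By Gronwall \<open>S\<^sub>t g\<^sub>k \<rightarrow> 1\<close> in \<open>L\<^sub>2(\<sigma> dx)\<close>, and monotone convergence in
  \<open>S\<^sub>t g\<^sub>k(x) = \<integral> K\<^sub>t(x; y) g\<^sub>k(y) dy\<close> gives the claim. Computing with the closed form requires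
  closability, which holds since \<open>C\<close> dominates \<open>\<theta>\<^sup>2 I\<close> for a smooth \<open>\<theta>\<close> vanishing only on the null
  set \<open>x\<^sub>1 = 0\<close>.
\<close>

section \<open>Smooth functions\<close>

text \<open>The constant 1 is not in \<open>L2\<close>, so it is reached only through cutoffs, and
  the comparison needs a weight under which 1 - g_k becomes small. This weight is itself
  differentiated inside the form, so its logarithm must have bounded energy density. Both weight and
  cutoffs are functions of P, and the requirement becomes: \<Gamma>(log P, log P) is bounded and P
  grows at least like |x|^2. The shape of P reflects the anisotropy. In the x1 directions the
  coefficient is at most a multiple of 1 + |x1|^2, because \<delta>1' < 1, and powers of 1 + |x1|^2
  tolerate that. In the x2 directions it may grow like |x1|^(2 \<delta>2') and meets a factor
  |x2|^2; the power \<kappa> is large enough to dominate this growth, so the product stays below a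
  multiple of P^2. Two definitions shape the rest: \<open>hbar\<close> is a limit along one chosen
  approximating sequence, usable only once all such sequences share their limit; and
  \<open>H_graph\<close> can be tested only on \<open>hdom\<close>, so multiplication by the weight
  has to preserve that domain.\<close>

lemma smooth_differentiable: "smooth f \<Longrightarrow> f differentiable (at x)"
  by (erule smooth.cases) auto

lemma smooth_frechet_derivative:
  "smooth f \<Longrightarrow> b \<in> Basis \<Longrightarrow> smooth (\<lambda>x. frechet_derivative f (at x) b)"
  by (erule smooth.cases) auto

lemma smooth_has_derivative:
  "smooth f \<Longrightarrow> (f has_derivative frechet_derivative f (at x)) (at x)"
  using smooth_differentiable frechet_derivative_works by blast

lemma smooth_continuous: "smooth f \<Longrightarrow> continuous_on A f"
  by (meson continuous_at_imp_continuous_on differentiable_imp_continuous_within smooth_differentiable)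

text \<open>Coinduction on \<open>smooth\<close> needs an invariant stable under differentiation: the closure of the
  smooth functions under the operations of interest.\<close>

inductive smooth_alg :: "('a::euclidean_space \<Rightarrow> real) \<Rightarrow> bool" where
  base: "smooth f \<Longrightarrow> smooth_alg f"
| add: "smooth_alg f \<Longrightarrow> smooth_alg g \<Longrightarrow> smooth_alg (\<lambda>x. f x + g x)"
| mult: "smooth_alg f \<Longrightarrow> smooth_alg g \<Longrightarrow> smooth_alg (\<lambda>x. f x * g x)"
| inv: "smooth_alg f \<Longrightarrow> \<forall>x. f x \<noteq> 0 \<Longrightarrow> smooth_alg (\<lambda>x. inverse (f x))"
| comp: "smooth G \<Longrightarrow> smooth_alg f \<Longrightarrow> smooth_alg (\<lambda>x. G (f x))"

lemma smooth_const: "smooth (\<lambda>x. c)"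
proof (coinduction arbitrary: c)
  case smooth
  show ?case by (auto simp: frechet_derivative_const intro!: exI[of _ 0])
qed

lemma frechet_derivative_eq:
  "(f has_derivative f') (at x) \<Longrightarrow> frechet_derivative f (at x) = f'"
  using frechet_derivative_at by metis

lemma frechet_derivative_eqI:
  "(\<And>x. (f has_derivative f' x) (at x)) \<Longrightarrow> (\<lambda>x. frechet_derivative f (at x) b) = (\<lambda>x. f' x b)"
  using frechet_derivative_eq by metis

text \<open>The sum, product, reciprocal and chain rules express each derivative through the same
  operations, so the closure is invariant under differentiation. The outer function of a composition
  has one real variable, which keeps the chain rule a single product.\<close>

lemma smooth_alg_derivative:
  assumes "smooth_alg f"
  shows "(\<forall>x. f differentiable (at x)) \<and> (\<forall>b\<in>Basis. smooth_alg (\<lambda>x. frechet_derivative f (at x) b))"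
  using assms
proof induction
  case (base f)
  then show ?case
    by (auto intro: smooth_alg.base smooth_differentiable smooth_frechet_derivative)
next
  case (add f g)
  then have D: "(f has_derivative frechet_derivative f (at x)) (at x)"
    "(g has_derivative frechet_derivative g (at x)) (at x)" for x
    using frechet_derivative_works by blast+
  have *: "((\<lambda>x. f x + g x) has_derivative
      (\<lambda>b. frechet_derivative f (at x) b + frechet_derivative g (at x) b)) (at x)" for x
    by (intro has_derivative_add D)
  have "\<forall>x. (\<lambda>x. f x + g x) differentiable (at x)"
    using * differentiableI by blast
  then show ?case
    unfolding frechet_derivative_eqI[OF *] using add by (auto intro!: smooth_alg.add)
next
  case (mult f g)
  then have D: "(f has_derivative frechet_derivative f (at x)) (at x)"
    "(g has_derivative frechet_derivative g (at x)) (at x)" for x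
    using frechet_derivative_works by blast+
  have *: "((\<lambda>x. f x * g x) has_derivative
      (\<lambda>b. f x * frechet_derivative g (at x) b + frechet_derivative f (at x) b * g x)) (at x)" for x
    by (intro has_derivative_mult D)
  have "\<forall>x. (\<lambda>x. f x * g x) differentiable (at x)"
    using * differentiableI by blast
  then show ?case
    unfolding frechet_derivative_eqI[OF *] using mult by (auto intro!: smooth_alg.add smooth_alg.mult)
next
  case (inv f)
  then have D: "(f has_derivative frechet_derivative f (at x)) (at x)" for x
    using frechet_derivative_works by blast
  have *: "((\<lambda>x. inverse (f x)) has_derivative
      (\<lambda>b. (-1) * (inverse (f x) * frechet_derivative f (at x) b * inverse (f x)))) (at x)" for x
    using Deriv.has_derivative_inverse[OF _ D] inv by simp
  have "\<forall>x. (\<lambda>x. inverse (f x)) differentiable (at x)"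
    using * differentiableI by blast
  moreover have "smooth_alg (\<lambda>x. inverse (f x))"
    using inv smooth_alg.inv by blast
  ultimately show ?case
    unfolding frechet_derivative_eqI[OF *] using inv
    by (intro conjI ballI smooth_alg.mult smooth_alg.base[OF smooth_const]) blast+
next
  case (comp G f)
  then have D: "(f has_derivative frechet_derivative f (at x)) (at x)" for x
    using frechet_derivative_works by blast
  \<comment> \<open>A linear map of the reals is determined by its value at 1; as 1 is the basis
    vector, that value is again a smooth function of the point.\<close>
  have DG: "frechet_derivative G (at y) c = c * frechet_derivative G (at y) 1" for y c
  proof -
    have "linear (frechet_derivative G (at y))"
      using smooth_has_derivative[OF comp.hyps(1)] has_derivative_linear by blast
    from linear_cmul[OF this, of c 1] show ?thesis by simp
  qed
  have "((\<lambda>x. G (f x)) has_derivative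
      (\<lambda>b. frechet_derivative G (at (f x)) (frechet_derivative f (at x) b))) (at x)" for x
    using has_derivative_compose[OF D smooth_has_derivative[OF comp.hyps(1)]] .
  then have *: "((\<lambda>x. G (f x)) has_derivative
      (\<lambda>b. frechet_derivative f (at x) b * frechet_derivative G (at (f x)) 1)) (at x)" for x
    by (subst (asm) DG)
  have "\<forall>x. (\<lambda>x. G (f x)) differentiable (at x)"
    using * differentiableI by blast
  moreover have "smooth (\<lambda>y. frechet_derivative G (at y) 1)"
    using smooth_frechet_derivative[OF comp.hyps(1)] by simp
  ultimately show ?case
    unfolding frechet_derivative_eqI[OF *]
    using comp smooth_alg.comp[of "\<lambda>y. frechet_derivative G (at y) 1" f]
    by (intro conjI ballI smooth_alg.mult) blast+
qed

lemma smooth_algD: "smooth_alg f \<Longrightarrow> smooth f"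
  by (coinduction arbitrary: f) (use smooth_alg_derivative in blast)

lemma smooth_add: "smooth f \<Longrightarrow> smooth g \<Longrightarrow> smooth (\<lambda>x. f x + g x)"
  and smooth_mult: "smooth f \<Longrightarrow> smooth g \<Longrightarrow> smooth (\<lambda>x. f x * g x)"
  and smooth_inverse: "smooth f \<Longrightarrow> (\<And>x. f x \<noteq> 0) \<Longrightarrow> smooth (\<lambda>x. inverse (f x))"
  and smooth_compose: "smooth G \<Longrightarrow> smooth f \<Longrightarrow> smooth (\<lambda>x. G (f x))"
  by (rule smooth_algD, erule (1) smooth_alg.add[OF smooth_alg.base smooth_alg.base])
     (rule smooth_algD, erule (1) smooth_alg.mult[OF smooth_alg.base smooth_alg.base],
      rule smooth_algD, erule smooth_alg.inv[OF smooth_alg.base], blast,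
      rule smooth_algD, erule smooth_alg.comp, erule smooth_alg.base)

lemma smooth_diff: "smooth f \<Longrightarrow> smooth g \<Longrightarrow> smooth (\<lambda>x. f x - g x)"
  using smooth_add[of f "\<lambda>x. (-1) * g x"] smooth_mult[OF smooth_const, of g "-1"] by simp

lemma smooth_power: "smooth f \<Longrightarrow> smooth (\<lambda>x. f x ^ n)"
  by (induction n) (auto intro: smooth_const smooth_mult)

lemma smooth_sum: "(\<And>i. i \<in> A \<Longrightarrow> smooth (f i)) \<Longrightarrow> smooth (\<lambda>x. \<Sum>i\<in>A. f i x)"
  by (induction A rule: infinite_finite_induct) (auto intro: smooth_const smooth_add)

lemma smooth_linear:
  assumes "bounded_linear f" shows "smooth f"
proof (rule smooth.intros)
  have *: "(f has_derivative f) (at x)" for x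
    using assms by (rule bounded_linear_imp_has_derivative)
  then show "\<forall>x. f differentiable (at x)" using differentiableI by blast
  show "\<forall>b\<in>Basis. smooth (\<lambda>x. frechet_derivative f (at x) b)"
    unfolding frechet_derivative_eqI[OF *] by (simp add: smooth_const)
qed

lemma smooth_nth: "smooth (\<lambda>x::real^'k::finite. x $ i)"
  by (intro smooth_linear bounded_linear_vec_nth)

text \<open>The polynomial prefactor makes the family of flat functions closed under differentiation.\<close>

definition flat :: "real poly \<Rightarrow> real \<Rightarrow> real" where
  "flat p z = (if z > 0 then poly p (inverse z) * exp (- inverse z) else 0)"

lemma poly_times_exp_minus_tendsto_0: "((\<lambda>y::real. poly p y * exp (- y)) \<longlongrightarrow> 0) at_top"
proof -
  have "((\<lambda>y::real. \<Sum>i\<le>degree p. coeff p i * (y ^ i / exp y)) \<longlongrightarrow> (\<Sum>i\<le>degree p. coeff p i * 0)) at_top"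
    by (intro tendsto_intros tendsto_power_div_exp_0)
  then show ?thesis
    by (simp add: poly_altdef sum_distrib_right exp_minus divide_inverse mult.assoc)
qed

text \<open>With y = 1/z one has dy/dz = -y^2, so p(y) exp(-y) has derivative y^2 (p - p')(y)
  exp(-y), and \<open>[:0,0,1:]\<close> is y^2. At 0 the right difference quotient is y p(y)
  exp(-y), the same kind of function with prefactor \<open>pCons 0 p\<close>, and it tends to
  0.\<close>

lemma flat_has_derivative:
  "(flat p has_real_derivative flat ([:0,0,1:] * (p - pderiv p)) z) (at z)"
proof -
  let ?q = "[:0,0,1:] * (p - pderiv p)"
  consider "z > 0" | "z < 0" | "z = 0" by linarith
  then show ?thesis
  proof cases
    case 1
    have "((\<lambda>z. poly p (inverse z) * exp (- inverse z)) has_real_derivative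
         poly ?q (inverse z) * exp (- inverse z)) (at z)"
      using 1 by (auto intro!: derivative_eq_intros simp: algebra_simps power2_eq_square)
    then have "((\<lambda>z. poly p (inverse z) * exp (- inverse z)) has_real_derivative flat ?q z) (at z)"
      using 1 by (simp add: flat_def)
    then show ?thesis
      by (rule has_field_derivative_transform_within_open[of _ _ _ "{0<..}"])
         (use 1 in \<open>auto simp: flat_def\<close>)
  next
    case 2
    have "((\<lambda>z. 0) has_real_derivative flat ?q z) (at z)"
      using 2 by (simp add: flat_def)
    then show ?thesis
      by (rule has_field_derivative_transform_within_open[of _ _ _ "{..<0}"])
         (use 2 in \<open>auto simp: flat_def\<close>)
  next
    case 3
    have "((\<lambda>h. flat p h / h) \<longlongrightarrow> 0) (at_right 0)"
    proof -
      have "((\<lambda>h::real. poly (pCons 0 p) (inverse h) * exp (- inverse h)) \<longlongrightarrow> 0) (at_right 0)"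
        by (rule filterlim_compose[OF poly_times_exp_minus_tendsto_0 filterlim_inverse_at_top_right])
      then show ?thesis
        by (rule Lim_transform_eventually)
           (auto simp: eventually_at_right_less flat_def field_simps eventually_at_filter)
    qed
    moreover have "((\<lambda>h. flat p h / h) \<longlongrightarrow> 0) (at_left 0)"
      by (rule tendsto_eventually) (auto simp: flat_def eventually_at_filter)
    ultimately have "((\<lambda>h. flat p h / h) \<longlongrightarrow> 0) (at 0)"
      by (simp add: filterlim_split_at)
    then show ?thesis
      using 3 by (simp add: DERIV_def flat_def)
  qed
qed

lemma smooth_flat: "smooth (flat p)"
proof (coinduction arbitrary: p)
  case smooth
  have *: "(flat p has_derivative (\<lambda>c. c * flat ([:0,0,1:] * (p - pderiv p)) z)) (at z)" for z
    using flat_has_derivative[of p z, unfolded has_field_derivative_def]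
    by (rule has_derivative_eq_rhs) (auto simp: fun_eq_iff)
  then have "\<forall>z. flat p differentiable (at z)" using differentiableI by blast
  then show ?case
    using frechet_derivative_eqI[OF *, of 1] by auto
qed

lemma flat_nonneg: "0 \<le> flat 1 z" and mono_flat: "mono (flat 1)"
  by (auto simp: flat_def mono_def le_imp_inverse_le)

text \<open>For z > 0 and y = 1/z this is y^2 exp(-y), the derivative of exp(-1/z); squaring y/2 <=
  exp(y/2) gives the constant 4. It bounds the slope of the cutoffs uniformly.\<close>

lemma flat_deriv_bound: "\<bar>flat [:0,0,1:] z\<bar> \<le> 4"
proof (cases "z > 0")
  case True
  define y where "y = inverse z"
  then have y: "y > 0" using True by simp
  have "(y/2)\<^sup>2 \<le> (1 + y/2)\<^sup>2" using y by (intro power_mono) auto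
  also have "\<dots> \<le> (exp (y/2))\<^sup>2"
    using y exp_ge_add_one_self[of "y/2"] by (intro power_mono) auto
  also have "\<dots> = exp y" by (simp add: power2_eq_square flip: exp_add)
  finally have "y\<^sup>2 \<le> 4 * exp y" by (simp add: power_divide)
  then have "y\<^sup>2 * exp (-y) \<le> 4" by (simp add: exp_minus field_simps)
  then show ?thesis using True y by (simp add: flat_def y_def abs_mult power2_eq_square)
qed (simp add: flat_def)

lemma flat_1_has_derivative: "(flat 1 has_real_derivative flat [:0,0,1:] z) (at z)"
  using flat_has_derivative[of 1 z] by (simp add: pderiv_1)

section \<open>Test functions and integration by parts\<close>

lemma smooth_partial: "smooth f \<Longrightarrow> smooth (partial i f)"
  unfolding partial_def[abs_def] by (rule smooth_frechet_derivative) (auto simp: axis_in_Basis_iff)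

lemma partial_const: "partial i (\<lambda>x. c) x = 0"
  by (simp add: partial_def)

lemma partial_add:
  "smooth f \<Longrightarrow> smooth g \<Longrightarrow> partial i (\<lambda>x. f x + g x) x = partial i f x + partial i g x"
  unfolding partial_def
  by (subst frechet_derivative_eq[OF has_derivative_add[OF smooth_has_derivative smooth_has_derivative]]) auto

lemma partial_diff:
  "smooth f \<Longrightarrow> smooth g \<Longrightarrow> partial i (\<lambda>x. f x - g x) x = partial i f x - partial i g x"
  unfolding partial_def
  by (subst frechet_derivative_eq[OF has_derivative_diff[OF smooth_has_derivative smooth_has_derivative]]) auto

lemma partial_mult:
  "smooth f \<Longrightarrow> smooth g \<Longrightarrow>
    partial i (\<lambda>x. f x * g x) x = f x * partial i g x + g x * partial i f x"
  unfolding partial_def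
  by (subst frechet_derivative_eq[OF has_derivative_mult[OF smooth_has_derivative smooth_has_derivative]]) auto

lemma partial_compose:
  assumes "smooth f" "(G has_real_derivative G') (at (f x))"
  shows "partial i (\<lambda>x. G (f x)) x = G' * partial i f x"
  using frechet_derivative_eq[OF has_derivative_compose[OF smooth_has_derivative[OF assms(1)]
     assms(2)[unfolded has_field_derivative_def]]]
  unfolding partial_def by simp

lemma partial_zero_off_support:
  assumes "x \<notin> closure {x. f x \<noteq> 0}" shows "partial i f x = 0"
proof -
  have "(f has_derivative (\<lambda>h. 0)) (at x)"
    by (rule has_derivative_transform_within_open[of "\<lambda>x. 0" _ _ _ "- closure {x. f x \<noteq> 0}"])
       (use assms closure_subset[of "{x. f x \<noteq> 0}"] in auto)
  from frechet_derivative_eq[OF this] show ?thesis by (simp add: partial_def)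
qed

lemma Cc_inf_smooth: "f \<in> Cc_inf \<Longrightarrow> smooth f"
  by (simp add: Cc_inf_def)

lemma Cc_infI:
  assumes "smooth h" "compact K" "\<And>x. x \<notin> K \<Longrightarrow> h x = 0"
  shows "h \<in> Cc_inf"
proof -
  have "closure {x. h x \<noteq> 0} \<subseteq> K"
    using assms by (intro closure_minimal) (auto intro: compact_imp_closed)
  then have "compact (closure {x. h x \<noteq> 0})"
    using compact_Int_closed[OF assms(2) closed_closure[of "{x. h x \<noteq> 0}"]] by (simp only: Int_absorb1)
  then show ?thesis using assms by (simp add: Cc_inf_def)
qed

lemma Cc_inf_support:
  assumes "f \<in> Cc_inf"
  shows "\<exists>K. compact K \<and> (\<forall>x. x \<notin> K \<longrightarrow> f x = 0 \<and> (\<forall>i. partial i f x = 0))"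
proof (intro exI conjI allI impI)
  show "compact (closure {x. f x \<noteq> 0})" using assms by (auto simp: Cc_inf_def)
  show "f x = 0" if "x \<notin> closure {x. f x \<noteq> 0}" for x
    using that closure_subset[of "{x. f x \<noteq> 0}"] by auto
qed (rule partial_zero_off_support)

lemma Cc_inf_add:
  fixes f g :: "real^'k::finite \<Rightarrow> real"
  assumes "f \<in> Cc_inf" "g \<in> Cc_inf" shows "(\<lambda>x. f x + g x) \<in> Cc_inf"
proof -
  obtain K where K: "compact K" "\<And>x. x \<notin> K \<Longrightarrow> f x = 0"
    "\<And>i x. x \<notin> K \<Longrightarrow> partial i f x = 0"
    using Cc_inf_support[OF assms(1)] by blast
  obtain L where L: "compact L" "\<And>x. x \<notin> L \<Longrightarrow> g x = 0"
    "\<And>i x. x \<notin> L \<Longrightarrow> partial i g x = 0"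
    using Cc_inf_support[OF assms(2)] by blast
  show ?thesis
    by (rule Cc_infI[of _ "K \<union> L"]) (use K L assms[THEN Cc_inf_smooth] in \<open>auto intro: smooth_add\<close>)
qed

lemma Cc_inf_mult:
  fixes f g :: "real^'k::finite \<Rightarrow> real"
  assumes "f \<in> Cc_inf" "smooth g" shows "(\<lambda>x. g x * f x) \<in> Cc_inf"
proof -
  obtain K where K: "compact K" "\<And>x. x \<notin> K \<Longrightarrow> f x = 0"
    "\<And>i x. x \<notin> K \<Longrightarrow> partial i f x = 0"
    using Cc_inf_support[OF assms(1)] by blast
  show ?thesis
    by (rule Cc_infI[of _ "K"]) (use K assms(2) Cc_inf_smooth[OF assms(1)] in \<open>auto intro: smooth_mult\<close>)
qed

lemma Cc_inf_diff: "(f :: real^'k::finite \<Rightarrow> real) \<in> Cc_inf \<Longrightarrow> g \<in> Cc_inf \<Longrightarrow> (\<lambda>x. f x - g x) \<in> Cc_inf"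
  using Cc_inf_add[of f "\<lambda>x. (-1) * g x"] Cc_inf_mult[OF _ smooth_const, of g "-1"] by simp

lemma Cc_inf_partial:
  assumes "f \<in> Cc_inf" shows "partial i f \<in> Cc_inf"
proof -
  obtain K where "compact K" "\<And>x. x \<notin> K \<Longrightarrow> partial i f x = 0"
    using Cc_inf_support[OF assms] by blast
  then show ?thesis by (rule Cc_infI[OF smooth_partial[OF Cc_inf_smooth[OF assms]]])
qed

section \<open>Integrability of test functions\<close>

lemma smooth_measurable [measurable_dest]: "smooth f \<Longrightarrow> f \<in> borel_measurable borel"
  by (intro borel_measurable_continuous_onI smooth_continuous)

text \<open>A continuous majorant is integrable over a compact set. Domination is asked for only
  almost everywhere because the coefficients of the form are controlled only up to null
  sets.\<close>

lemma integrable_compact_support: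
  fixes h c :: "'a::euclidean_space \<Rightarrow> real"
  assumes "compact K" "continuous_on UNIV c" "h \<in> borel_measurable borel"
    and "AE x in lborel. \<bar>h x\<bar> \<le> c x" "\<And>x. x \<notin> K \<Longrightarrow> h x = 0"
  shows "integrable lborel h"
proof (rule Bochner_Integration.integrable_bound)
  show "integrable lborel (\<lambda>x. indicator K x *\<^sub>R c x)"
    using assms by (intro borel_integrable_compact) (auto intro: continuous_on_subset)
  show "AE x in lborel. norm (h x) \<le> norm (indicator K x *\<^sub>R c x)"
    using assms(4) by eventually_elim (use assms(5) in \<open>auto simp: indicator_def\<close>)
qed (use assms in simp)

lemma Cc_inf_integrable_mult:
  fixes f g :: "real^'k::finite \<Rightarrow> real"
  assumes "f \<in> Cc_inf" "smooth g" shows "integrable lborel (\<lambda>x. g x * f x)"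
proof -
  obtain K where K: "compact K"
     "\<And>x. x \<notin> K \<Longrightarrow> g x * f x = 0"
    "\<And>i x. x \<notin> K \<Longrightarrow> partial i (\<lambda>x. g x * f x) x = 0"
    using Cc_inf_support[OF Cc_inf_mult[OF assms]] by blast
  show ?thesis
    by (rule integrable_compact_support[OF K(1) _ _ _ K(2), where c="\<lambda>x. \<bar>g x * f x\<bar>"])
       (use smooth_mult[OF assms(2) Cc_inf_smooth[OF assms(1)]] in
         \<open>simp_all add: smooth_measurable continuous_on_rabs[OF smooth_continuous]\<close>)
qed

lemma Cc_inf_integrable: "(f :: real^'k::finite \<Rightarrow> real) \<in> Cc_inf \<Longrightarrow> integrable lborel f"
  using Cc_inf_integrable_mult[OF _ smooth_const, of f 1] by simp

lemma Cc_inf_L2: "f \<in> Cc_inf \<Longrightarrow> f \<in> L2"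
  using Cc_inf_integrable_mult[of f f] by (auto simp: L2_def power2_eq_square Cc_inf_smooth smooth_measurable)

lemma Cc_inf_bounded:
  assumes "f \<in> Cc_inf" obtains M where "\<And>x. \<bar>f x\<bar> \<le> M"
proof -
  let ?K = "closure {x. f x \<noteq> 0}"
  have "bounded (f ` ?K)"
    using assms by (intro compact_imp_bounded compact_continuous_image)
       (auto simp: Cc_inf_def intro: smooth_continuous)
  then obtain M where M: "\<And>x. x \<in> ?K \<Longrightarrow> \<bar>f x\<bar> \<le> M" by (auto simp: bounded_iff)
  have "\<bar>f x\<bar> \<le> max M 0" for x
    using M[of x] closure_subset[of "{x. f x \<noteq> 0}"] by (cases "f x = 0") (auto simp: le_max_iff_disj)
  then show ?thesis by (rule that)
qed

section \<open>Translation invariance and integration by parts\<close>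

lemma lborel_integral_translate:
  fixes f :: "'a::euclidean_space \<Rightarrow> real"
  assumes [measurable]: "f \<in> borel_measurable borel"
  shows "(\<integral>x. f (c + x) \<partial>lborel) = (\<integral>x. f x \<partial>lborel)"
proof -
  have "(\<integral>x. f x \<partial>lborel) = (\<integral>x. f x \<partial>distr lborel borel ((+) c))"
    by (simp add: lborel_distr_plus)
  also have "\<dots> = (\<integral>x. f (c + x) \<partial>lborel)" by (subst integral_distr) auto
  finally show ?thesis by simp
qed

lemma lborel_integrable_translate:
  fixes f :: "'a::euclidean_space \<Rightarrow> real"
  assumes "integrable lborel f"
  shows "integrable lborel (\<lambda>x. f (c + x))"
proof -
  have "integrable (distr lborel borel ((+) c)) f" using assms by (simp add: lborel_distr_plus)
  then show ?thesis by (subst (asm) integrable_distr_eq) (use assms in auto)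
qed

text \<open>Translation invariance makes every difference quotient integrate to zero; dominated
  convergence passes this on to the derivative.\<close>

lemma integral_partial_eq_0:
  fixes f :: "real^'k::finite \<Rightarrow> real"
  assumes f: "f \<in> Cc_inf" shows "(\<integral>x. partial i f x \<partial>lborel) = 0"
proof -
  define e :: "real^'k" where "e = axis i 1"
  define h where "h n = inverse (real (Suc n))" for n
  have h: "0 < h n" "h n \<le> 1" for n by (auto simp: h_def field_simps)
  note sm = Cc_inf_smooth[OF f]
  obtain K where K: "compact K" "\<And>x. x \<notin> K \<Longrightarrow> f x = 0" "\<And>i x. x \<notin> K \<Longrightarrow> partial i f x = 0"
    using Cc_inf_support[OF f] by blast
  note [measurable] = smooth_measurable[OF sm] smooth_measurable[OF smooth_partial[OF sm]]
  obtain R where R: "\<And>x. x \<in> K \<Longrightarrow> norm x \<le> R" using compact_imp_bounded[OF K(1)] by (auto simp: bounded_iff)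
  obtain M where M: "\<And>x. \<bar>partial i f x\<bar> \<le> M" using Cc_inf_bounded[OF Cc_inf_partial[OF f]] by blast
  have D: "((\<lambda>t. f (x + t *\<^sub>R e)) has_real_derivative partial i f (x + t *\<^sub>R e)) (at t)" for x t
  proof -
    have 1: "((\<lambda>t. x + t *\<^sub>R e) has_derivative (\<lambda>t. t *\<^sub>R e)) (at t)"
      by (auto intro!: derivative_eq_intros)
    have "frechet_derivative f (at y) (c *\<^sub>R e) = c * partial i f y" for y c
      using linear_cmul[OF has_derivative_linear[OF smooth_has_derivative[OF sm]]]
      by (simp add: partial_def e_def)
    with has_derivative_compose[OF 1 smooth_has_derivative[OF sm]]
    have "((\<lambda>t. f (x + t *\<^sub>R e)) has_derivative (\<lambda>c. c * partial i f (x + t *\<^sub>R e))) (at t)" by simp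
    then show ?thesis
      unfolding has_field_derivative_def by (rule has_derivative_eq_rhs) (auto simp: fun_eq_iff)
  qed
  define q where "q n x = (f (h n *\<^sub>R e + x) - f x) / h n" for n x
  have lim: "(\<lambda>n. \<integral>x. q n x \<partial>lborel) \<longlonglongrightarrow> (\<integral>x. partial i f x \<partial>lborel)"
  \<comment> \<open>The steps \<open>h n\<close> are at most 1, so every quotient vanishes off the
    ball of radius R + 1; inside, the mean value theorem bounds it by the bound M of the
    derivative.\<close>
  proof (rule integral_dominated_convergence[where w="\<lambda>x. indicator (cball 0 (R + 1)) x *\<^sub>R M"])
    show "integrable lborel (\<lambda>x::real^'k. indicator (cball 0 (R + 1)) x *\<^sub>R M)"
      by (intro borel_integrable_compact) auto
    show "AE x in lborel. (\<lambda>n. q n x) \<longlonglongrightarrow> partial i f x"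
    proof (rule AE_I2)
      fix x
      have "((\<lambda>t. (f (x + t *\<^sub>R e) - f x) / t) \<longlongrightarrow> partial i f x) (at 0)"
        using D[of x 0] by (simp add: DERIV_def)
      moreover have "filterlim h (at 0) sequentially"
        unfolding filterlim_at h_def using LIMSEQ_inverse_real_of_nat by auto
      ultimately show "(\<lambda>n. q n x) \<longlonglongrightarrow> partial i f x"
        unfolding q_def by (subst add.commute) (rule filterlim_compose)
    qed
    show "AE x in lborel. norm (q n x) \<le> indicator (cball 0 (R + 1)) x *\<^sub>R M" for n
    proof (rule AE_I2)
      fix x
      obtain z where z: "f (x + h n *\<^sub>R e) - f (x + 0 *\<^sub>R e) = (h n - 0) * partial i f (x + z *\<^sub>R e)"
        using MVT2[OF h(1)[of n], of "\<lambda>t. f (x + t *\<^sub>R e)" "\<lambda>t. partial i f (x + t *\<^sub>R e)"] D by blast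
      then have "q n x = partial i f (x + z *\<^sub>R e)"
        using h[of n] by (simp add: q_def add.commute)
      then have "\<bar>q n x\<bar> \<le> M" using M by simp
      moreover have "q n x = 0" if "x \<notin> cball 0 (R+1)"
      proof -
        have x: "norm x > R + 1" using that by auto
        have "norm x \<le> norm (h n *\<^sub>R e + x) + norm (h n *\<^sub>R e)"
          by (metis add_diff_cancel_left' norm_triangle_ineq4 add.commute)
        moreover have "norm (h n *\<^sub>R e) \<le> 1" using h[of n] by (simp add: e_def)
        ultimately have "norm (h n *\<^sub>R e + x) > R" using x by simp
        then have "h n *\<^sub>R e + x \<notin> K" "x \<notin> K" using x R by force+
        then show ?thesis using K(2) by (simp add: q_def)
      qed
      ultimately show "norm (q n x) \<le> indicator (cball 0 (R + 1)) x *\<^sub>R M"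
        by (auto simp: indicator_def)
    qed
  qed (auto simp: q_def)
  have "(\<integral>x. q n x \<partial>lborel) = 0" for n
    using lborel_integral_translate[of f "h n *\<^sub>R e"] lborel_integrable_translate[of f "h n *\<^sub>R e"] Cc_inf_integrable[OF f]
    by (simp add: q_def)
  then show ?thesis using lim LIMSEQ_unique[OF lim, of 0] by simp
qed

lemma integral_by_parts:
  assumes f: "f \<in> Cc_inf" and g: "g \<in> Cc_inf"
  shows "(\<integral>x. f x * partial i g x \<partial>lborel) = - (\<integral>x. partial i f x * g x \<partial>lborel)"
proof -
  note s = Cc_inf_smooth[OF f] Cc_inf_smooth[OF g]
  have "0 = (\<integral>x. f x * partial i g x + partial i f x * g x \<partial>lborel)"
    using integral_partial_eq_0[OF Cc_inf_mult[OF g s(1)], of i] partial_mult[OF s] by (simp add: mult.commute)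
  also have "\<dots> = (\<integral>x. f x * partial i g x \<partial>lborel) + (\<integral>x. partial i f x * g x \<partial>lborel)"
    by (intro Bochner_Integration.integral_add Cc_inf_integrable_mult Cc_inf_partial smooth_partial f g s)
  finally show ?thesis by simp
qed

section \<open>The space \<open>L\<^sub>2\<close>\<close>

lemma L2_measurable [measurable_dest]: "f \<in> L2 \<Longrightarrow> f \<in> borel_measurable borel"
  by (simp add: L2_def)

lemma L2_integrable_mult:
  assumes "f \<in> L2" "g \<in> L2" shows "integrable lborel (\<lambda>x. f x * g x)"
proof (rule Bochner_Integration.integrable_bound)
  show "integrable lborel (\<lambda>x. (f x)\<^sup>2 + (g x)\<^sup>2)" using assms by (auto simp: L2_def)
  show "AE x in lborel. norm (f x * g x) \<le> norm ((f x)\<^sup>2 + (g x)\<^sup>2)"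
  proof (rule AE_I2)
    fix x
    have "0 \<le> \<bar>f x\<bar> * \<bar>g x\<bar>" by simp
    then show "norm (f x * g x) \<le> norm ((f x)\<^sup>2 + (g x)\<^sup>2)"
      using sum_squares_bound[of "\<bar>f x\<bar>" "\<bar>g x\<bar>"]
      unfolding real_norm_def abs_mult power2_abs mult.assoc by linarith
  qed
qed (use assms in \<open>auto simp: L2_def\<close>)

lemma L2_add: "f \<in> L2 \<Longrightarrow> g \<in> L2 \<Longrightarrow> (\<lambda>x. f x + g x) \<in> L2"
  using L2_integrable_mult[of f g] by (auto simp: L2_def power2_sum mult.assoc)

lemma L2_bounded_mult:
  assumes "f \<in> L2" "c \<in> borel_measurable borel" "\<And>x. \<bar>c x\<bar> \<le> M"
  shows "(\<lambda>x. c x * f x) \<in> L2"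
proof -
  have "integrable lborel (\<lambda>x. (c x * f x)\<^sup>2)"
  proof (rule Bochner_Integration.integrable_bound)
    show "integrable lborel (\<lambda>x. M\<^sup>2 * (f x)\<^sup>2)" using assms by (auto simp: L2_def)
    have "(c x)\<^sup>2 \<le> M\<^sup>2" for x using assms(3)[of x] by (metis abs_ge_zero power2_abs power_mono)
    then show "AE x in lborel. norm ((c x * f x)\<^sup>2) \<le> norm (M\<^sup>2 * (f x)\<^sup>2)"
      by (intro AE_I2) (auto simp: power_mult_distrib intro: mult_right_mono)
  qed (use assms in \<open>auto simp: L2_def\<close>)
  then show ?thesis using assms by (auto simp: L2_def)
qed

lemma L2_cmult: "f \<in> L2 \<Longrightarrow> (\<lambda>x. c * f x) \<in> L2"
  using L2_bounded_mult[of f "\<lambda>x. c" "\<bar>c\<bar>"] by simp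

lemma L2_diff: "f \<in> L2 \<Longrightarrow> g \<in> L2 \<Longrightarrow> (\<lambda>x. f x - g x) \<in> L2"
  using L2_add[of f "\<lambda>x. (-1) * g x"] L2_cmult[of g "-1"] by simp

text \<open>With A and D the squared norms of f and g and B their inner product, integrating (A g -
  B f)^2 gives A (A D - B^2) >= 0. If A = 0, then f vanishes almost everywhere and B = 0.\<close>

lemma L2_Cauchy_Schwarz:
  assumes f: "f \<in> L2" and g: "g \<in> L2"
  shows "\<bar>L2_inner f g\<bar> \<le> sqrt (\<integral>x. (f x)\<^sup>2 \<partial>lborel) * sqrt (\<integral>x. (g x)\<^sup>2 \<partial>lborel)"
proof -
  define A B D where "A = (\<integral>x. (f x)\<^sup>2 \<partial>lborel)" "B = L2_inner f g" "D = (\<integral>x. (g x)\<^sup>2 \<partial>lborel)"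
  have A: "A \<ge> 0" by (simp add: A_B_D_def)
  have i: "integrable lborel (\<lambda>x. (f x)\<^sup>2)" "integrable lborel (\<lambda>x. (g x)\<^sup>2)" "integrable lborel (\<lambda>x. f x * g x)"
    using f g L2_integrable_mult[OF f g] by (auto simp: L2_def)
  have "B\<^sup>2 \<le> A * D"
  proof (cases "A = 0")
    case True
    then have "AE x in lborel. (f x)\<^sup>2 = 0"
      using i integral_nonneg_eq_0_iff_AE[of lborel "\<lambda>x. (f x)\<^sup>2"] by (simp add: A_B_D_def)
    then have "B = 0" unfolding A_B_D_def L2_inner_def by (intro integral_eq_zero_AE) auto
    then show ?thesis using True by simp
  next
    case False
    have "0 \<le> (\<integral>x. (A * g x - B * f x)\<^sup>2 \<partial>lborel)" by simp
    also have "\<dots> = (\<integral>x. A\<^sup>2 * (g x)\<^sup>2 + B\<^sup>2 * (f x)\<^sup>2 - 2 * A * B * (f x * g x) \<partial>lborel)"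
      by (simp add: power2_diff power_mult_distrib algebra_simps)
    also have "\<dots> = A\<^sup>2 * D + B\<^sup>2 * A - 2 * A * B * B"
      using i by (simp add: A_B_D_def L2_inner_def)
    also have "\<dots> = A * (A * D - B\<^sup>2)" by (simp add: power2_eq_square algebra_simps)
    finally show ?thesis using A False by (simp add: zero_le_mult_iff)
  qed
  then have "sqrt (B\<^sup>2) \<le> sqrt (A * D)" by (rule real_sqrt_le_mono)
  then show ?thesis by (simp add: A_B_D_def real_sqrt_mult)
qed

lemma L2_inner_add:
  assumes "f \<in> L2" "g \<in> L2" "h \<in> L2"
  shows "L2_inner (\<lambda>x. f x + g x) h = L2_inner f h + L2_inner g h"
    and "L2_inner h (\<lambda>x. f x + g x) = L2_inner h f + L2_inner h g"
    and "L2_inner (\<lambda>x. f x - g x) h = L2_inner f h - L2_inner g h"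
    and "L2_inner h (\<lambda>x. f x - g x) = L2_inner h f - L2_inner h g"
  using L2_integrable_mult[OF assms(1,3)] L2_integrable_mult[OF assms(2,3)]
  by (simp_all add: L2_inner_def ring_distribs mult.commute[of "h _"])

lemma L2_dist2_commute: "L2_dist2 f g = L2_dist2 g f"
  by (simp add: L2_dist2_def power2_commute)

lemma L2_dist2_nonneg: "0 \<le> L2_dist2 f g"
  by (simp add: L2_dist2_def)

text \<open>\<open>L2_dist2\<close> is the square of a distance, hence the factors 2; the slack is
  the integral of ((f - g) - (g - h))^2.\<close>

lemma L2_dist2_triangle:
  assumes "f \<in> L2" "g \<in> L2" "h \<in> L2"
  shows "L2_dist2 f h \<le> 2 * L2_dist2 f g + 2 * L2_dist2 g h"
proof -
  have i: "integrable lborel (\<lambda>x. (f x - g x)\<^sup>2)" "integrable lborel (\<lambda>x. (g x - h x)\<^sup>2)" "integrable lborel (\<lambda>x. (f x - h x)\<^sup>2)"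
    using assms L2_diff by (auto simp: L2_def)
  have "L2_dist2 f h \<le> (\<integral>x. 2 * (f x - g x)\<^sup>2 + 2 * (g x - h x)\<^sup>2 \<partial>lborel)"
    unfolding L2_dist2_def
  proof (rule integral_mono)
    show "(f x - h x)\<^sup>2 \<le> 2 * (f x - g x)\<^sup>2 + 2 * (g x - h x)\<^sup>2" for x
      using zero_le_power2[of "(f x - g x) - (g x - h x)"] by (simp add: power2_eq_square algebra_simps)
  qed (use i in auto)
  also have "\<dots> = 2 * L2_dist2 f g + 2 * L2_dist2 g h"
    using i by (simp add: L2_dist2_def)
  finally show ?thesis .
qed

lemma L2_dist2_add_le:
  assumes "f \<in> L2" "g \<in> L2" "f' \<in> L2" "g' \<in> L2"
  shows "L2_dist2 (\<lambda>x. f x + g x) (\<lambda>x. f' x + g' x) \<le> 2 * L2_dist2 f f' + 2 * L2_dist2 g g'"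
    and "L2_dist2 (\<lambda>x. f x - g x) (\<lambda>x. f' x - g' x) \<le> 2 * L2_dist2 f f' + 2 * L2_dist2 g g'"
proof -
  have 1: "L2_dist2 (\<lambda>x. a x + c x) (\<lambda>x. b x + c x) = L2_dist2 a b"
    "L2_dist2 (\<lambda>x. a x - c x) (\<lambda>x. b x - c x) = L2_dist2 a b"
    "L2_dist2 (\<lambda>x. c x + a x) (\<lambda>x. c x + b x) = L2_dist2 a b"
    "L2_dist2 (\<lambda>x. c x - a x) (\<lambda>x. c x - b x) = L2_dist2 a b" for a b c :: "real^'a::finite \<Rightarrow> real"
    by (simp_all add: L2_dist2_def power2_commute)
  show "L2_dist2 (\<lambda>x. f x + g x) (\<lambda>x. f' x + g' x) \<le> 2 * L2_dist2 f f' + 2 * L2_dist2 g g'"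
    using L2_dist2_triangle[of "\<lambda>x. f x + g x" "\<lambda>x. f' x + g x" "\<lambda>x. f' x + g' x"] assms
    by (simp add: L2_add 1)
  show "L2_dist2 (\<lambda>x. f x - g x) (\<lambda>x. f' x - g' x) \<le> 2 * L2_dist2 f f' + 2 * L2_dist2 g g'"
    using L2_dist2_triangle[of "\<lambda>x. f x - g x" "\<lambda>x. f' x - g x" "\<lambda>x. f' x - g' x"] assms
    by (simp add: L2_diff 1)
qed

text \<open>Expanding around the limits leaves three terms, each bounded by Cauchy-Schwarz. The
  filter is general and membership only eventual, so that the lemma serves both sequences and limits
  in time, where membership is known for nonnegative times.\<close>

lemma L2_inner_tendsto:
  fixes f' g' :: "real^'k::finite \<Rightarrow> real"
  assumes f: "\<forall>\<^sub>F k in F. f k \<in> L2" "f' \<in> L2" "((\<lambda>k. L2_dist2 (f k) f') \<longlongrightarrow> 0) F"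
    and g: "\<forall>\<^sub>F k in F. g k \<in> L2" "g' \<in> L2" "((\<lambda>k. L2_dist2 (g k) g') \<longlongrightarrow> 0) F"
  shows "((\<lambda>k. L2_inner (f k) (g k)) \<longlongrightarrow> L2_inner f' g') F"
proof -
  define N where "N = (\<lambda>f::real^'k \<Rightarrow> real. sqrt (\<integral>x. (f x)\<^sup>2 \<partial>lborel))"
  define bound where "bound k = sqrt (L2_dist2 (f k) f') * sqrt (L2_dist2 (g k) g')
    + N f' * sqrt (L2_dist2 (g k) g') + sqrt (L2_dist2 (f k) f') * N g'" for k
  have "((\<lambda>k. L2_inner (f k) (g k) - L2_inner f' g') \<longlongrightarrow> 0) F"
  proof (rule Lim_null_comparison)
    show "\<forall>\<^sub>F k in F. norm (L2_inner (f k) (g k) - L2_inner f' g') \<le> bound k"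
      using f(1) g(1)
    proof eventually_elim
      case (elim k)
      let ?a = "\<lambda>x. f k x - f' x" and ?b = "\<lambda>x. g k x - g' x"
      have ab: "?a \<in> L2" "?b \<in> L2" using elim f g by (auto intro: L2_diff)
      have "L2_inner (f k) (g k) - L2_inner f' g' = L2_inner ?a ?b + L2_inner f' ?b + L2_inner ?a g'"
        using elim f g ab by (simp add: L2_inner_add)
      moreover have "\<bar>L2_inner ?a ?b\<bar> \<le> sqrt (L2_dist2 (f k) f') * sqrt (L2_dist2 (g k) g')"
        "\<bar>L2_inner f' ?b\<bar> \<le> N f' * sqrt (L2_dist2 (g k) g')"
        "\<bar>L2_inner ?a g'\<bar> \<le> sqrt (L2_dist2 (f k) f') * N g'"
        using L2_Cauchy_Schwarz ab f(2) g(2) unfolding L2_dist2_def N_def by blast+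
      ultimately show ?case unfolding bound_def real_norm_def by linarith
    qed
    have "(bound \<longlongrightarrow> sqrt 0 * sqrt 0 + N f' * sqrt 0 + sqrt 0 * N g') F"
      unfolding bound_def by (intro tendsto_intros f g)
    then show "(bound \<longlongrightarrow> 0) F" by simp
  qed
  then show ?thesis by (simp add: LIM_zero_iff)
qed

lemma L2_dist2_bounded_mult:
  assumes "f \<in> L2" "g \<in> L2" "c \<in> borel_measurable borel" "\<And>x. \<bar>c x\<bar> \<le> M"
  shows "L2_dist2 (\<lambda>x. c x * f x) (\<lambda>x. c x * g x) \<le> M\<^sup>2 * L2_dist2 f g"
proof -
  have 1: "(\<lambda>x. f x - g x) \<in> L2" "(\<lambda>x. c x * (f x - g x)) \<in> L2"
    using assms L2_bounded_mult[OF L2_diff] L2_diff by blast+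
  have c: "(c x)\<^sup>2 \<le> M\<^sup>2" for x using assms(4)[of x] by (metis abs_ge_zero power2_abs power_mono)
  have "(\<integral>x. (c x * (f x - g x))\<^sup>2 \<partial>lborel) \<le> (\<integral>x. M\<^sup>2 * (f x - g x)\<^sup>2 \<partial>lborel)"
    by (rule integral_mono) (use 1 c in \<open>auto simp: L2_def power_mult_distrib intro: mult_right_mono\<close>)
  then show ?thesis by (simp add: L2_dist2_def right_diff_distrib)
qed

section \<open>Degenerate forms and closability\<close>

definition grad :: "(real^'k::finite \<Rightarrow> real) \<Rightarrow> real^'k \<Rightarrow> real^'k" where
  "grad f x = (\<chi> i. partial i f x)"

lemma grad_add: "smooth f \<Longrightarrow> smooth g \<Longrightarrow> grad (\<lambda>x. f x + g x) x = grad f x + grad g x"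
  and grad_diff: "smooth f \<Longrightarrow> smooth g \<Longrightarrow> grad (\<lambda>x. f x - g x) x = grad f x - grad g x"
  and grad_mult: "smooth f \<Longrightarrow> smooth g \<Longrightarrow> grad (\<lambda>x. f x * g x) x = f x *\<^sub>R grad g x + g x *\<^sub>R grad f x"
  and grad_cmult: "smooth g \<Longrightarrow> grad (\<lambda>x. c * g x) x = c *\<^sub>R grad g x"
  using partial_mult[OF smooth_const, of g _ c]
  by (simp_all add: grad_def vec_eq_iff partial_add partial_diff partial_mult partial_const)

lemma grad_compose:
  assumes "smooth f" "(G has_real_derivative G') (at (f x))"
  shows "grad (\<lambda>x. G (f x)) x = G' *\<^sub>R grad f x"
  by (simp add: grad_def vec_eq_iff partial_compose[OF assms])

text \<open>The sign of c is not given: a suitable t excludes c < 0, c = 0 forces b = 0, and for c >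
  0 the minimum at t = -b/c is evaluated.\<close>

lemma quadratic_discriminant_bound:
  fixes a b c :: real
  assumes "\<And>t. 0 \<le> a + 2 * t * b + t\<^sup>2 * c"
  shows "b\<^sup>2 \<le> a * c"
proof (cases "c = 0")
  case True
  have "b = 0"
  proof (rule ccontr)
    assume "b \<noteq> 0"
    \<comment> \<open>At this t the expression equals a - (a + 1) = -1.\<close>
    then show False using assms[of "- (a + 1) / (2 * b)"] True by (simp add: field_simps)
  qed
  then show ?thesis using True by simp
next
  case False
  have "c > 0"
  proof (rule ccontr)
    assume "\<not> c > 0"
    then have c: "c < 0" using False by simp
    \<comment> \<open>Chosen so that t >= 1 and t (-c) = |a| + 2 |b| - c; then t^2 (-c) exceeds a +
      2 t b.\<close>
    define t where "t = \<bar>a\<bar> / - c + 2 * \<bar>b\<bar> / - c + 1"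
    have t: "t \<ge> 1" using c by (simp add: t_def field_simps)
    have "t * (- c) = \<bar>a\<bar> + 2 * \<bar>b\<bar> - c" using c by (simp add: t_def field_simps)
    then have "t * (t * (- c)) = t * (\<bar>a\<bar> + 2 * \<bar>b\<bar> - c)" by simp
    also have "\<dots> = t * \<bar>a\<bar> + 2 * t * \<bar>b\<bar> - t * c" by (simp add: algebra_simps)
    finally have "t\<^sup>2 * c = - (t * \<bar>a\<bar>) - 2 * t * \<bar>b\<bar> + t * c" by (simp add: power2_eq_square)
    moreover have "t * \<bar>a\<bar> \<ge> a" using t mult_right_mono[of 1 t "\<bar>a\<bar>"] by simp
    moreover have "2 * t * \<bar>b\<bar> \<ge> 2 * t * b" using t by (intro mult_left_mono) auto
    moreover have "t * c < 0" using t c by (simp add: mult_pos_neg)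
    ultimately show False using assms[of t] by linarith
  qed
  then show ?thesis using assms[of "- b / c"] by (simp add: field_simps power2_eq_square)
qed

text \<open>Ellipticity is recorded as bounds by scalar functions. The lower one may degenerate on a
  null set, but \<theta> is smooth so that \<theta>^2 times a derivative of a test function is again
  a test function; \<Lambda> is continuous so that test functions have finite energy.\<close>

locale degenerate_form =
  fixes C :: "real^'k::finite \<Rightarrow> real^'k^'k" and \<theta> \<Lambda> :: "real^'k \<Rightarrow> real"
  assumes C_measurable: "\<And>i j. (\<lambda>x. C x $ i $ j) \<in> borel_measurable borel"
    and C_symmetric: "\<And>x. transpose (C x) = C x"
    and \<theta>_smooth: "smooth \<theta>"
    and \<theta>_nonzero: "AE x in lborel. \<theta> x \<noteq> 0"
    and \<Lambda>_continuous: "continuous_on UNIV \<Lambda>"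
    and C_lower: "AE x in lborel. \<forall>\<xi>. (\<theta> x)\<^sup>2 * (\<xi> \<bullet> \<xi>) \<le> \<xi> \<bullet> (C x *v \<xi>)"
    and C_upper: "AE x in lborel. \<forall>\<xi>. \<xi> \<bullet> (C x *v \<xi>) \<le> \<Lambda> x * (\<xi> \<bullet> \<xi>)"
begin

section \<open>The energy density (carre du champ) and its form on test functions\<close>

definition \<Gamma> :: "(real^'k \<Rightarrow> real) \<Rightarrow> (real^'k \<Rightarrow> real) \<Rightarrow> real^'k \<Rightarrow> real" where
  "\<Gamma> f g x = grad f x \<bullet> (C x *v grad g x)"

definition form :: "(real^'k \<Rightarrow> real) \<Rightarrow> (real^'k \<Rightarrow> real) \<Rightarrow> real" where
  "form f g = (\<integral>x. \<Gamma> f g x \<partial>lborel)"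

lemma \<Gamma>_sum: "\<Gamma> f g x = (\<Sum>i\<in>UNIV. \<Sum>j\<in>UNIV. partial i f x * (C x $ i $ j) * partial j g x)"
  by (simp add: \<Gamma>_def grad_def inner_vec_def matrix_vector_mult_def sum_distrib_left mult.assoc)

lemma hform_eq: "hform C f = form f f"
  by (simp add: hform_def form_def \<Gamma>_sum)

lemma C_inner_commute: "\<xi> \<bullet> (C x *v \<eta>) = \<eta> \<bullet> (C x *v \<xi>)"
  using C_symmetric[of x] dot_lmul_matrix[of \<xi> "C x" \<eta>] transpose_matrix_vector[of "C x" \<xi>]
  by (simp add: inner_commute)

lemma C_psd: "AE x in lborel. \<forall>\<xi>. 0 \<le> \<xi> \<bullet> (C x *v \<xi>)"
  using C_lower by eventually_elim (meson inner_ge_zero mult_nonneg_nonneg order_trans zero_le_power2)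

lemma \<Gamma>_nonneg: "AE x in lborel. 0 \<le> \<Gamma> f f x"
  using C_psd by eventually_elim (simp add: \<Gamma>_def)

lemma \<Gamma>_measurable:
  "smooth f \<Longrightarrow> smooth g \<Longrightarrow> \<Gamma> f g \<in> borel_measurable borel"
  unfolding \<Gamma>_sum
  by (intro borel_measurable_sum borel_measurable_times C_measurable smooth_measurable smooth_partial)

text \<open>Positivity of C at a + b and a - b gives 2 |a . C b| <= a . C a + b . C b, so the
  diagonal bound \<Lambda> controls the mixed terms too and yields a continuous majorant. The weight
  \<open>w\<close> serves the energy of the cutoffs against \<sigma>.\<close>

lemma \<Gamma>_integrable_weighted:
  assumes f: "f \<in> Cc_inf" and g: "g \<in> Cc_inf" and w: "smooth w"
  shows "integrable lborel (\<lambda>x. w x * \<Gamma> f g x)"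
proof -
  note s = Cc_inf_smooth[OF f] Cc_inf_smooth[OF g]
  obtain K where K: "compact K" "\<And>x i. x \<notin> K \<Longrightarrow> partial i f x = 0"
    using Cc_inf_support[OF f] by blast
  define c where "c x = \<bar>w x\<bar> * (\<Lambda> x * ((grad f x \<bullet> grad f x + grad g x \<bullet> grad g x) / 2))" for x
  show ?thesis
  proof (rule integrable_compact_support[OF K(1), where c=c])
    show "continuous_on UNIV c" unfolding c_def grad_def inner_vec_def
      by (auto intro!: continuous_intros \<Lambda>_continuous smooth_continuous[OF w]
            smooth_continuous[OF smooth_partial[OF s(1)]] smooth_continuous[OF smooth_partial[OF s(2)]])
    show "(\<lambda>x. w x * \<Gamma> f g x) \<in> borel_measurable borel"
      using \<Gamma>_measurable[OF s] smooth_measurable[OF w] by simp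
    show "w x * \<Gamma> f g x = 0" if "x \<notin> K" for x using K(2)[OF that] by (simp add: \<Gamma>_sum)
    show "AE x in lborel. \<bar>w x * \<Gamma> f g x\<bar> \<le> c x"
      using C_psd C_upper
    proof eventually_elim
      case (elim x)
      let ?a = "grad f x" and ?b = "grad g x" and ?A = "C x"
      have "0 \<le> (?a + ?b) \<bullet> (?A *v (?a + ?b))" "0 \<le> (?a - ?b) \<bullet> (?A *v (?a - ?b))"
        using elim by blast+
      then have "2 * \<bar>?a \<bullet> (?A *v ?b)\<bar> \<le> ?a \<bullet> (?A *v ?a) + ?b \<bullet> (?A *v ?b)"
        using C_inner_commute[of ?a x ?b]
        by (auto simp: inner_add_left inner_add_right inner_diff_left inner_diff_right
              matrix_vector_right_distrib matrix_vector_mult_diff_distrib abs_if)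
      also have "\<dots> \<le> \<Lambda> x * (?a \<bullet> ?a) + \<Lambda> x * (?b \<bullet> ?b)" using elim by (simp add: add_mono)
      finally have "\<bar>\<Gamma> f g x\<bar> \<le> \<Lambda> x * ((?a \<bullet> ?a + ?b \<bullet> ?b) / 2)"
        by (simp add: \<Gamma>_def field_simps)
      then show ?case unfolding c_def abs_mult by (intro mult_left_mono) auto
    qed
  qed
qed

lemma \<Gamma>_integrable: "f \<in> Cc_inf \<Longrightarrow> g \<in> Cc_inf \<Longrightarrow> integrable lborel (\<Gamma> f g)"
  using \<Gamma>_integrable_weighted[OF _ _ smooth_const, of f g 1] by simp

lemma \<Gamma>_commute: "\<Gamma> f g x = \<Gamma> g f x"
  unfolding \<Gamma>_def by (rule C_inner_commute)

lemma \<Gamma>_add: "smooth f \<Longrightarrow> smooth g \<Longrightarrow> \<Gamma> (\<lambda>x. f x + g x) h x = \<Gamma> f h x + \<Gamma> g h x"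
  and \<Gamma>_diff: "smooth f \<Longrightarrow> smooth g \<Longrightarrow> \<Gamma> (\<lambda>x. f x - g x) h x = \<Gamma> f h x - \<Gamma> g h x"
  by (simp_all add: \<Gamma>_def grad_add grad_diff inner_add_left inner_diff_left)

lemma form_commute: "form f g = form g f"
  unfolding form_def by (rule Bochner_Integration.integral_cong) (auto intro: \<Gamma>_commute)

lemma form_nonneg: "0 \<le> form f f"
  unfolding form_def by (intro integral_nonneg_AE \<Gamma>_nonneg)

lemma hform_nonneg: "0 \<le> hform C f"
  by (simp add: hform_eq form_nonneg)

lemma form_add:
  assumes "f \<in> Cc_inf" "g \<in> Cc_inf" "h \<in> Cc_inf"
  shows "form (\<lambda>x. f x + g x) h = form f h + form g h"
    and "form (\<lambda>x. f x - g x) h = form f h - form g h"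
proof -
  note s = Cc_inf_smooth[OF assms(1)] Cc_inf_smooth[OF assms(2)]
  have "\<Gamma> (\<lambda>x. f x + g x) h = (\<lambda>x. \<Gamma> f h x + \<Gamma> g h x)" "\<Gamma> (\<lambda>x. f x - g x) h = (\<lambda>x. \<Gamma> f h x - \<Gamma> g h x)"
    using \<Gamma>_add[OF s] \<Gamma>_diff[OF s] by blast+
  then show "form (\<lambda>x. f x + g x) h = form f h + form g h"
    and "form (\<lambda>x. f x - g x) h = form f h - form g h"
    using assms by (simp_all add: form_def \<Gamma>_integrable)
qed

lemma form_cmult: "g \<in> Cc_inf \<Longrightarrow> form (\<lambda>x. c * g x) h = c * form g h"
  unfolding form_def \<Gamma>_def by (simp add: grad_cmult Cc_inf_smooth)

lemma form_add_self:
  assumes "f \<in> Cc_inf" "g \<in> Cc_inf"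
  shows "form (\<lambda>x. f x + g x) (\<lambda>x. f x + g x) = form f f + 2 * form f g + form g g"
    and "form (\<lambda>x. f x - g x) (\<lambda>x. f x - g x) = form f f - 2 * form f g + form g g"
proof -
  have "form (\<lambda>x. f x + g x) (\<lambda>x. f x + g x) = form f (\<lambda>x. f x + g x) + form g (\<lambda>x. f x + g x)"
    by (intro form_add assms Cc_inf_add)
  also have "\<dots> = form (\<lambda>x. f x + g x) f + form (\<lambda>x. f x + g x) g"
    by (simp add: form_commute[of f] form_commute[of g])
  finally show "form (\<lambda>x. f x + g x) (\<lambda>x. f x + g x) = form f f + 2 * form f g + form g g"
    using assms by (simp add: form_add form_commute[of g f])
  have "form (\<lambda>x. f x - g x) (\<lambda>x. f x - g x) = form f (\<lambda>x. f x - g x) - form g (\<lambda>x. f x - g x)"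
    by (intro form_add assms Cc_inf_diff)
  also have "\<dots> = form (\<lambda>x. f x - g x) f - form (\<lambda>x. f x - g x) g"
    by (simp add: form_commute[of f] form_commute[of g])
  finally show "form (\<lambda>x. f x - g x) (\<lambda>x. f x - g x) = form f f - 2 * form f g + form g g"
    using assms by (simp add: form_add form_commute[of g f])
qed

lemma form_polarization:
  assumes "f \<in> Cc_inf" "g \<in> Cc_inf"
  shows "form f g = (hform C (\<lambda>x. f x + g x) - hform C (\<lambda>x. f x - g x)) / 4"
  using form_add_self[OF assms] by (simp add: hform_eq)

lemma hform_add_le:
  assumes "f \<in> Cc_inf" "g \<in> Cc_inf"
  shows "hform C (\<lambda>x. f x + g x) \<le> 2 * hform C f + 2 * hform C g"
    and "hform C (\<lambda>x. f x - g x) \<le> 2 * hform C f + 2 * hform C g"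
  using form_add_self[OF assms] form_nonneg[of "\<lambda>x. f x - g x"] form_nonneg[of "\<lambda>x. f x + g x"]
  by (simp_all add: hform_eq)

lemma form_Cauchy_Schwarz:
  assumes f: "f \<in> Cc_inf" and g: "g \<in> Cc_inf"
  shows "\<bar>form f g\<bar> \<le> sqrt (hform C f) * sqrt (hform C g)"
proof -
  have "(form f g)\<^sup>2 \<le> form f f * form g g"
  proof (rule quadratic_discriminant_bound)
    fix t
    have tg: "(\<lambda>x. t * g x) \<in> Cc_inf" using Cc_inf_mult[OF g smooth_const] .
    have "form f (\<lambda>x. t * g x) = t * form f g" "form (\<lambda>x. t * g x) (\<lambda>x. t * g x) = t\<^sup>2 * form g g"
      using form_cmult[OF g] form_commute by (simp_all add: power2_eq_square)
    then show "0 \<le> form f f + 2 * t * form f g + t\<^sup>2 * form g g"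
      using form_nonneg[of "\<lambda>x. f x + t * g x"] form_add_self(1)[OF f tg] by simp
  qed
  then have "sqrt ((form f g)\<^sup>2) \<le> sqrt (form f f * form g g)" by (rule real_sqrt_le_mono)
  then show ?thesis by (simp add: hform_eq real_sqrt_mult)
qed

text \<open>Cauchy-Schwarz in the expanded square gives the reverse triangle inequality of the form
  seminorm; it turns form-Cauchy sequences into convergent energies.\<close>

lemma sqrt_hform_diff:
  assumes f: "f \<in> Cc_inf" and g: "g \<in> Cc_inf"
  shows "\<bar>sqrt (hform C f) - sqrt (hform C g)\<bar> \<le> sqrt (hform C (\<lambda>x. f x - g x))"
proof -
  have n: "0 \<le> hform C h" for h by (simp add: hform_eq form_nonneg)
  have "(sqrt (hform C f) - sqrt (hform C g))\<^sup>2 = hform C f + hform C g - 2 * (sqrt (hform C f) * sqrt (hform C g))"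
    using n by (simp add: power2_diff)
  also have "\<dots> \<le> hform C (\<lambda>x. f x - g x)"
    using form_Cauchy_Schwarz[OF f g] form_add_self(2)[OF f g] by (simp add: hform_eq)
  finally have "sqrt ((sqrt (hform C f) - sqrt (hform C g))\<^sup>2) \<le> sqrt (hform C (\<lambda>x. f x - g x))"
    by (rule real_sqrt_le_mono)
  then show ?thesis by simp
qed

text \<open>The fields \<open>\<theta> \<partial>\<^sub>i \<zeta>\<^sub>k\<close> are Cauchy in \<open>L\<^sub>2\<close>, and each is orthogonal to the limit because
  \<open>\<theta>\<^sup>2 \<partial>\<^sub>i \<zeta>\<^sub>k\<close> is itself a test function; so they tend to zero, and Fatou's lemma along an almost
  everywhere convergent subsequence controls the form.\<close>

lemma hform_closable:
  assumes \<zeta>: "\<And>k. \<zeta> k \<in> Cc_inf"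
    and null: "(\<lambda>k. \<integral>x. (\<zeta> k x)\<^sup>2 \<partial>lborel) \<longlonglongrightarrow> 0"
    and Cauchy: "\<And>e. e > 0 \<Longrightarrow> \<exists>N. \<forall>k\<ge>N. \<forall>l\<ge>N. hform C (\<lambda>x. \<zeta> k x - \<zeta> l x) < e"
  shows "(\<lambda>k. hform C (\<zeta> k)) \<longlonglongrightarrow> 0"
proof -
  note s = Cc_inf_smooth[OF \<zeta>]
  define Y where "Y k i x = \<theta> x * partial i (\<zeta> k) x" for k i x
  have Y: "Y k i \<in> Cc_inf" for k i
    unfolding Y_def[abs_def] by (intro Cc_inf_mult Cc_inf_partial \<zeta> \<theta>_smooth)
  have Y2: "integrable lborel (\<lambda>x. (Y k i x)\<^sup>2)" for k i using Cc_inf_L2[OF Y] by (simp add: L2_def)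
  \<comment> \<open>With k fixed, integration by parts moves the derivative from
    \<open>\<zeta> l\<close> onto the test function \<theta> times \<open>Y k i\<close>, and
    \<open>\<zeta> l\<close> tends to 0 in \<open>L2\<close>.\<close>
  have orth: "(\<lambda>l. L2_inner (Y k i) (Y l i)) \<longlonglongrightarrow> 0" for k i
  proof -
    define w where "w = (\<lambda>x. \<theta> x * Y k i x)"
    have w: "w \<in> Cc_inf" unfolding w_def by (intro Cc_inf_mult Y \<theta>_smooth)
    have "L2_inner (Y k i) (Y l i) = - L2_inner (partial i w) (\<zeta> l)" for l
      using integral_by_parts[OF w \<zeta>[of l], of i] by (simp add: L2_inner_def w_def Y_def algebra_simps)
    moreover have "(\<lambda>l. L2_inner (partial i w) (\<zeta> l)) \<longlonglongrightarrow> L2_inner (partial i w) (\<lambda>x. 0)"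
      by (rule L2_inner_tendsto)
         (use null Cc_inf_L2[OF \<zeta>] Cc_inf_L2[OF Cc_inf_partial[OF w]] in \<open>auto simp: L2_dist2_def, simp add: L2_def\<close>)
    ultimately show ?thesis by (simp add: L2_inner_def tendsto_minus_cancel_left[symmetric])
  qed
  have Y_le: "(\<integral>x. (Y k i x - Y l i x)\<^sup>2 \<partial>lborel) \<le> hform C (\<lambda>x. \<zeta> k x - \<zeta> l x)" for k l i
    unfolding hform_eq form_def
  proof (rule integral_mono_AE)
    show "integrable lborel (\<lambda>x. (Y k i x - Y l i x)\<^sup>2)"
      using Cc_inf_L2[OF Cc_inf_diff[OF Y Y]] by (simp add: L2_def)
    show "integrable lborel (\<Gamma> (\<lambda>x. \<zeta> k x - \<zeta> l x) (\<lambda>x. \<zeta> k x - \<zeta> l x))"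
      by (intro \<Gamma>_integrable Cc_inf_diff \<zeta>)
    show "AE x in lborel. (Y k i x - Y l i x)\<^sup>2 \<le> \<Gamma> (\<lambda>x. \<zeta> k x - \<zeta> l x) (\<lambda>x. \<zeta> k x - \<zeta> l x) x"
      using C_lower
    proof eventually_elim
      case (elim x)
      let ?g = "grad (\<lambda>x. \<zeta> k x - \<zeta> l x) x"
      have "(?g $ i)\<^sup>2 \<le> ?g \<bullet> ?g"
        unfolding inner_vec_def power2_eq_square by (simp, rule member_le_sum) auto
      then have "(\<theta> x)\<^sup>2 * (?g $ i)\<^sup>2 \<le> (\<theta> x)\<^sup>2 * (?g \<bullet> ?g)" by (intro mult_left_mono) auto
      moreover have "Y k i x - Y l i x = \<theta> x * (?g $ i)"
        by (simp add: Y_def grad_def partial_diff[OF s s] right_diff_distrib)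
      ultimately show ?case using elim by (auto simp: \<Gamma>_def power_mult_distrib intro: order_trans)
    qed
  qed
  \<comment> \<open>For large k and l, |Y_k|^2 + |Y_l|^2 - 2 (Y_k, Y_l) is at most e/2 in
    \<open>L2\<close>. Dropping |Y_l|^2 and letting l tend to infinity with k fixed removes the
    mixed term by \<open>orth\<close>.\<close>
  have Y_null: "(\<lambda>k. \<integral>x. (Y k i x)\<^sup>2 \<partial>lborel) \<longlonglongrightarrow> 0" for i
  proof (rule LIMSEQ_I)
    fix e :: real assume e: "e > 0"
    obtain N where N: "\<forall>k\<ge>N. \<forall>l\<ge>N. hform C (\<lambda>x. \<zeta> k x - \<zeta> l x) < e / 2"
      using Cauchy[of "e/2"] e by auto
    have "(\<integral>x. (Y k i x)\<^sup>2 \<partial>lborel) \<le> e / 2" if k: "k \<ge> N" for k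
    proof -
      have "(\<integral>x. (Y k i x)\<^sup>2 \<partial>lborel) \<le> e / 2 + 2 * L2_inner (Y k i) (Y l i)" if l: "l \<ge> N" for l
      proof -
        have i: "integrable lborel (\<lambda>x. Y k i x * Y l i x)"
          by (intro L2_integrable_mult Cc_inf_L2 Y)
        have "(\<integral>x. (Y k i x - Y l i x)\<^sup>2 \<partial>lborel)
            = (\<integral>x. (Y k i x)\<^sup>2 + (Y l i x)\<^sup>2 - 2 * (Y k i x * Y l i x) \<partial>lborel)"
          by (simp add: power2_diff mult.assoc)
        also have "\<dots> = (\<integral>x. (Y k i x)\<^sup>2 \<partial>lborel) + (\<integral>x. (Y l i x)\<^sup>2 \<partial>lborel) - 2 * L2_inner (Y k i) (Y l i)"
          using i Y2 by (simp add: L2_inner_def)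
        finally have eq: "(\<integral>x. (Y k i x - Y l i x)\<^sup>2 \<partial>lborel)
            = (\<integral>x. (Y k i x)\<^sup>2 \<partial>lborel) + (\<integral>x. (Y l i x)\<^sup>2 \<partial>lborel) - 2 * L2_inner (Y k i) (Y l i)" .
        have "hform C (\<lambda>x. \<zeta> k x - \<zeta> l x) < e / 2" using N k l by blast
        moreover have "0 \<le> (\<integral>x. (Y l i x)\<^sup>2 \<partial>lborel)" by simp
        ultimately show ?thesis using Y_le[of k i l] unfolding eq by linarith
      qed
      then have "\<exists>N. \<forall>l\<ge>N. (\<integral>x. (Y k i x)\<^sup>2 \<partial>lborel) \<le> e / 2 + 2 * L2_inner (Y k i) (Y l i)" by blast
      moreover have "(\<lambda>l. e / 2 + 2 * L2_inner (Y k i) (Y l i)) \<longlonglongrightarrow> e / 2"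
        using tendsto_add[OF tendsto_const tendsto_mult[OF tendsto_const orth[of k i], of 2], of "e/2"] by simp
      ultimately show ?thesis using LIMSEQ_le_const by blast
    qed
    then have "norm ((\<integral>x. (Y k i x)\<^sup>2 \<partial>lborel) - 0) < e" if "k \<ge> N" for k
      using that e by (force simp: abs_of_nonneg)
    then show "\<exists>N. \<forall>k\<ge>N. norm ((\<integral>x. (Y k i x)\<^sup>2 \<partial>lborel) - 0) < e" by blast
  qed
  \<comment> \<open>Summing over the coordinates lets one subsequence serve all partial derivatives
    at once.\<close>
  define u where "u k x = (\<Sum>i\<in>UNIV. (Y k i x)\<^sup>2)" for k x
  have u_nonneg: "0 \<le> u k x" for k x by (simp add: u_def sum_nonneg)
  have "(\<lambda>k. \<integral>x. norm (u k x) \<partial>lborel) \<longlonglongrightarrow> 0"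
  proof -
    have "(\<integral>x. norm (u k x) \<partial>lborel) = (\<Sum>i\<in>UNIV. \<integral>x. (Y k i x)\<^sup>2 \<partial>lborel)" for k
      using Y2 u_nonneg[of k] by (simp add: u_def)
    moreover have "(\<lambda>k. \<Sum>i\<in>UNIV. \<integral>x. (Y k i x)\<^sup>2 \<partial>lborel) \<longlonglongrightarrow> (\<Sum>i\<in>(UNIV :: 'k set). 0)"
      by (intro tendsto_sum Y_null)
    ultimately show ?thesis by simp
  qed
  moreover have "integrable lborel (u k)" for k
    unfolding u_def[abs_def] by (intro Bochner_Integration.integrable_sum Y2)
  ultimately obtain r where r: "strict_mono r" and ae: "AE x in lborel. (\<lambda>n. u (r n) x) \<longlonglongrightarrow> 0"
    using tendsto_L1_AE_subseq[of lborel u] by blast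
  have partial_null: "AE x in lborel. \<forall>i. (\<lambda>n. partial i (\<zeta> (r n)) x) \<longlonglongrightarrow> 0"
    using ae \<theta>_nonzero
  proof eventually_elim
    case (elim x)
    show ?case
    proof
      fix i
      have "(\<lambda>n. (Y (r n) i x)\<^sup>2) \<longlonglongrightarrow> 0"
      proof (rule tendsto_sandwich[OF _ _ tendsto_const elim(1)])
        show "\<forall>\<^sub>F n in sequentially. (Y (r n) i x)\<^sup>2 \<le> u (r n) x"
          unfolding u_def by (intro always_eventually allI member_le_sum) auto
      qed auto
      then have "(\<lambda>n. Y (r n) i x) \<longlonglongrightarrow> 0" by simp
      then have "(\<lambda>n. Y (r n) i x / \<theta> x) \<longlonglongrightarrow> 0" by (rule tendsto_divide_zero)
      then show "(\<lambda>n. partial i (\<zeta> (r n)) x) \<longlonglongrightarrow> 0" using elim by (simp add: Y_def)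
    qed
  qed
  show ?thesis
  proof (rule LIMSEQ_I)
    fix e :: real assume e: "e > 0"
    obtain N where N: "\<forall>k\<ge>N. \<forall>l\<ge>N. hform C (\<lambda>x. \<zeta> k x - \<zeta> l x) < e / 2"
      using Cauchy[of "e/2"] e by auto
    have "hform C (\<zeta> k) \<le> e / 2" if k: "k \<ge> N" for k
    proof -
      \<comment> \<open>Fatou is applied in n with k fixed: the gradient of this difference tends to
        that of \<open>\<zeta> k\<close> almost everywhere, while its energy is eventually below e/2
        by the Cauchy property.\<close>
      let ?d = "\<lambda>n x. \<zeta> k x - \<zeta> (r n) x"
      have d: "?d n \<in> Cc_inf" for n by (intro Cc_inf_diff \<zeta>)
      have hn: "ennreal (hform C f) = (\<integral>\<^sup>+x. ennreal (\<Gamma> f f x) \<partial>lborel)" if "f \<in> Cc_inf" for f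
        unfolding hform_eq form_def
        by (rule nn_integral_eq_integral[symmetric]) (intro \<Gamma>_integrable \<Gamma>_nonneg that)+
      have "AE x in lborel. liminf (\<lambda>n. ennreal (\<Gamma> (?d n) (?d n) x)) = ennreal (\<Gamma> (\<zeta> k) (\<zeta> k) x)"
        using partial_null
      proof eventually_elim
        case (elim x)
        have "(\<lambda>n. \<Gamma> (?d n) (?d n) x) \<longlonglongrightarrow>
            (\<Sum>i\<in>UNIV. \<Sum>j\<in>UNIV. (partial i (\<zeta> k) x - 0) * (C x $ i $ j) * (partial j (\<zeta> k) x - 0))"
          unfolding \<Gamma>_sum partial_diff[OF s s] using elim by (intro tendsto_intros) auto
        then have "(\<lambda>n. \<Gamma> (?d n) (?d n) x) \<longlonglongrightarrow> \<Gamma> (\<zeta> k) (\<zeta> k) x" by (simp add: \<Gamma>_sum)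
        then have "(\<lambda>n. ennreal (\<Gamma> (?d n) (?d n) x)) \<longlonglongrightarrow> ennreal (\<Gamma> (\<zeta> k) (\<zeta> k) x)"
          by (rule tendsto_ennrealI)
        then show ?case by (intro lim_imp_Liminf) auto
      qed
      then have "ennreal (hform C (\<zeta> k)) = (\<integral>\<^sup>+x. liminf (\<lambda>n. ennreal (\<Gamma> (?d n) (?d n) x)) \<partial>lborel)"
        unfolding hn[OF \<zeta>] by (intro nn_integral_cong_AE) auto
      also have "\<dots> \<le> liminf (\<lambda>n. \<integral>\<^sup>+x. ennreal (\<Gamma> (?d n) (?d n) x) \<partial>lborel)"
        by (rule nn_integral_liminf) (use \<Gamma>_measurable[OF Cc_inf_smooth[OF d] Cc_inf_smooth[OF d]] in simp)
      also have "\<dots> = liminf (\<lambda>n. ennreal (hform C (?d n)))" by (simp add: hn[OF d])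
      also have "\<dots> \<le> ennreal (e / 2)"
      proof (rule Liminf_le)
        show "\<forall>\<^sub>F n in sequentially. ennreal (hform C (?d n)) \<le> ennreal (e / 2)"
          using eventually_ge_at_top[of N]
        proof eventually_elim
          case (elim n)
          then have "r n \<ge> N" using seq_suble[OF r, of n] by simp
          then show ?case using N k by (intro ennreal_leI less_imp_le) auto
        qed
      qed simp
      finally show ?thesis using e by simp
    qed
    then have "norm (hform C (\<zeta> k) - 0) < e" if "k \<ge> N" for k
      using that e form_nonneg[of "\<zeta> k"] by (force simp: abs_of_nonneg hform_eq)
    then show "\<exists>N. \<forall>k\<ge>N. norm (hform C (\<zeta> k) - 0) < e" by blast
  qed
qed

section \<open>Approximating sequences and the closed form\<close>

lemma approx_seqD:
  assumes "approx_seq C \<phi> u"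
  shows "\<phi> k \<in> Cc_inf" "(\<lambda>k. L2_dist2 (\<phi> k) u) \<longlonglongrightarrow> 0"
    "e > 0 \<Longrightarrow> \<exists>N. \<forall>k\<ge>N. \<forall>l\<ge>N. hform C (\<lambda>x. \<phi> k x - \<phi> l x) < e"
  using assms by (auto simp: approx_seq_def)

lemma approx_seq_combine:
  assumes a: "approx_seq C \<phi> u" "approx_seq C \<psi> v" and L2: "u \<in> L2" "v \<in> L2"
  shows "approx_seq C (\<lambda>k x. \<phi> k x + \<psi> k x) (\<lambda>x. u x + v x)"
    and "approx_seq C (\<lambda>k x. \<phi> k x - \<psi> k x) (\<lambda>x. u x - v x)"
proof -
  note \<phi> = approx_seqD[OF a(1)] and \<psi> = approx_seqD[OF a(2)]
  have z: "(\<lambda>k. 2 * L2_dist2 (\<phi> k) u + 2 * L2_dist2 (\<psi> k) v) \<longlonglongrightarrow> 0"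
    using tendsto_add[OF tendsto_mult_right_zero[OF \<phi>(2), of 2] tendsto_mult_right_zero[OF \<psi>(2), of 2]] by simp
  have Cauchy: "\<exists>N. \<forall>k\<ge>N. \<forall>l\<ge>N. 2 * hform C (\<lambda>x. \<phi> k x - \<phi> l x) + 2 * hform C (\<lambda>x. \<psi> k x - \<psi> l x) < e"
    if e: "e > 0" for e
  proof -
    obtain N1 where N1: "\<forall>k\<ge>N1. \<forall>l\<ge>N1. hform C (\<lambda>x. \<phi> k x - \<phi> l x) < e/4"
      using \<phi>(3)[of "e/4"] e by auto
    obtain N2 where N2: "\<forall>k\<ge>N2. \<forall>l\<ge>N2. hform C (\<lambda>x. \<psi> k x - \<psi> l x) < e/4"
      using \<psi>(3)[of "e/4"] e by auto
    show ?thesis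
    proof (intro exI[of _ "max N1 N2"] allI impI)
      fix k l assume "max N1 N2 \<le> k" "max N1 N2 \<le> l"
      then have "hform C (\<lambda>x. \<phi> k x - \<phi> l x) < e/4" "hform C (\<lambda>x. \<psi> k x - \<psi> l x) < e/4"
        using N1 N2 by auto
      then show "2 * hform C (\<lambda>x. \<phi> k x - \<phi> l x) + 2 * hform C (\<lambda>x. \<psi> k x - \<psi> l x) < e" by linarith
    qed
  qed
  show "approx_seq C (\<lambda>k x. \<phi> k x + \<psi> k x) (\<lambda>x. u x + v x)"
    unfolding approx_seq_def
  proof (intro conjI allI impI)
    show "(\<lambda>x. \<phi> k x + \<psi> k x) \<in> Cc_inf" for k by (intro Cc_inf_add \<phi> \<psi>)
    show "(\<lambda>k. L2_dist2 (\<lambda>x. \<phi> k x + \<psi> k x) (\<lambda>x. u x + v x)) \<longlonglongrightarrow> 0"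
      by (rule tendsto_sandwich[OF _ _ tendsto_const z])
         (auto simp: L2_dist2_nonneg intro!: always_eventually L2_dist2_add_le Cc_inf_L2 \<phi> \<psi> L2)
    fix e :: real assume "e > 0"
    have "hform C (\<lambda>x. (\<phi> k x + \<psi> k x) - (\<phi> l x + \<psi> l x))
       \<le> 2 * hform C (\<lambda>x. \<phi> k x - \<phi> l x) + 2 * hform C (\<lambda>x. \<psi> k x - \<psi> l x)" for k l
      using hform_add_le(1)[OF Cc_inf_diff[OF \<phi>(1)[of k] \<phi>(1)[of l]] Cc_inf_diff[OF \<psi>(1)[of k] \<psi>(1)[of l]]]
      by (simp add: algebra_simps)
    then show "\<exists>N. \<forall>k\<ge>N. \<forall>l\<ge>N. hform C (\<lambda>x. (\<phi> k x + \<psi> k x) - (\<phi> l x + \<psi> l x)) < e"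
      using Cauchy[OF \<open>e > 0\<close>] order_le_less_trans by blast
  qed
  show "approx_seq C (\<lambda>k x. \<phi> k x - \<psi> k x) (\<lambda>x. u x - v x)"
    unfolding approx_seq_def
  proof (intro conjI allI impI)
    show "(\<lambda>x. \<phi> k x - \<psi> k x) \<in> Cc_inf" for k by (intro Cc_inf_diff \<phi> \<psi>)
    show "(\<lambda>k. L2_dist2 (\<lambda>x. \<phi> k x - \<psi> k x) (\<lambda>x. u x - v x)) \<longlonglongrightarrow> 0"
      by (rule tendsto_sandwich[OF _ _ tendsto_const z])
         (auto simp: L2_dist2_nonneg intro!: always_eventually L2_dist2_add_le Cc_inf_L2 \<phi> \<psi> L2)
    fix e :: real assume "e > 0"
    have "hform C (\<lambda>x. (\<phi> k x - \<psi> k x) - (\<phi> l x - \<psi> l x))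
       \<le> 2 * hform C (\<lambda>x. \<phi> k x - \<phi> l x) + 2 * hform C (\<lambda>x. \<psi> k x - \<psi> l x)" for k l
      using hform_add_le(2)[OF Cc_inf_diff[OF \<phi>(1)[of k] \<phi>(1)[of l]] Cc_inf_diff[OF \<psi>(1)[of k] \<psi>(1)[of l]]]
      by (simp add: algebra_simps)
    then show "\<exists>N. \<forall>k\<ge>N. \<forall>l\<ge>N. hform C (\<lambda>x. (\<phi> k x - \<psi> k x) - (\<phi> l x - \<psi> l x)) < e"
      using Cauchy[OF \<open>e > 0\<close>] order_le_less_trans by blast
  qed
qed

text \<open>\<open>hbar\<close> takes its limit along the sequence picked by \<open>SOME\<close>.
  The difference of two sequences approximating u tends to 0 in \<open>L2\<close> and is Cauchy in
  the form, so by closability its energy tends to 0 and both sequences give the same value.\<close>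

lemma hform_tendsto_hbar:
  assumes a: "approx_seq C \<phi> u" and u: "u \<in> L2"
  shows "(\<lambda>k. hform C (\<phi> k)) \<longlonglongrightarrow> hbar C u"
proof -
  define \<psi> where "\<psi> = (SOME \<phi>. approx_seq C \<phi> u)"
  have b: "approx_seq C \<psi> u" unfolding \<psi>_def using someI[of "\<lambda>\<phi>. approx_seq C \<phi> u", OF a] .
  note \<phi> = approx_seqD[OF a] and \<psi> = approx_seqD[OF b]
  have "Cauchy (\<lambda>k. sqrt (hform C (\<psi> k)))"
  proof (rule CauchyI)
    fix e :: real assume e: "e > 0"
    obtain N where N: "\<forall>k\<ge>N. \<forall>l\<ge>N. hform C (\<lambda>x. \<psi> k x - \<psi> l x) < e\<^sup>2"
      using \<psi>(3)[of "e\<^sup>2"] e by auto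
    have "norm (sqrt (hform C (\<psi> m)) - sqrt (hform C (\<psi> n))) < e" if "m \<ge> N" "n \<ge> N" for m n
    proof -
      have "sqrt (hform C (\<lambda>x. \<psi> m x - \<psi> n x)) < sqrt (e\<^sup>2)" using N that by (intro real_sqrt_less_mono) auto
      then show ?thesis using sqrt_hform_diff[OF \<psi>(1) \<psi>(1), of m n] e by simp
    qed
    then show "\<exists>N. \<forall>m\<ge>N. \<forall>n\<ge>N. norm (sqrt (hform C (\<psi> m)) - sqrt (hform C (\<psi> n))) < e" by blast
  qed
  then obtain L where L: "(\<lambda>k. sqrt (hform C (\<psi> k))) \<longlonglongrightarrow> L"
    using Cauchy_convergent_iff convergent_def by blast
  have sq: "(sqrt (hform C f))\<^sup>2 = hform C f" for f using hform_nonneg by simp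
  have "(\<lambda>k. hform C (\<psi> k)) \<longlonglongrightarrow> L\<^sup>2" using tendsto_power[OF L, of 2] by (simp add: sq)
  then have hbar: "hbar C u = L\<^sup>2" unfolding hbar_def \<psi>_def by (rule limI)
  have "(\<lambda>k. hform C (\<lambda>x. \<phi> k x - \<psi> k x)) \<longlonglongrightarrow> 0"
  proof (rule hform_closable)
    note c = approx_seqD[OF approx_seq_combine(2)[OF a b u u]]
    show "(\<lambda>x. \<phi> k x - \<psi> k x) \<in> Cc_inf" for k by (rule c)
    show "(\<lambda>k. \<integral>x. (\<phi> k x - \<psi> k x)\<^sup>2 \<partial>lborel) \<longlonglongrightarrow> 0" using c(2) by (simp add: L2_dist2_def)
    show "\<exists>N. \<forall>k\<ge>N. \<forall>l\<ge>N. hform C (\<lambda>x. (\<phi> k x - \<psi> k x) - (\<phi> l x - \<psi> l x)) < e" if "e > 0" for e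
      using c(3)[OF that] .
  qed
  then have "(\<lambda>k. sqrt (hform C (\<lambda>x. \<phi> k x - \<psi> k x))) \<longlonglongrightarrow> sqrt 0" by (rule tendsto_real_sqrt)
  then have lim: "(\<lambda>k. sqrt (hform C (\<lambda>x. \<phi> k x - \<psi> k x))) \<longlonglongrightarrow> 0" by simp
  have "(\<lambda>k. sqrt (hform C (\<phi> k)) - sqrt (hform C (\<psi> k))) \<longlonglongrightarrow> 0"
    by (rule Lim_null_comparison[OF _ lim], unfold real_norm_def)
       (intro always_eventually allI sqrt_hform_diff \<phi>(1) \<psi>(1))
  from tendsto_add[OF this L] have "(\<lambda>k. sqrt (hform C (\<phi> k))) \<longlonglongrightarrow> L" by simp
  from tendsto_power[OF this, of 2] show ?thesis by (simp add: sq hbar)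
qed

lemma form_tendsto_hbar2:
  assumes a: "approx_seq C \<phi> u" "approx_seq C \<psi> v" and L2: "u \<in> L2" "v \<in> L2"
  shows "(\<lambda>k. form (\<phi> k) (\<psi> k)) \<longlonglongrightarrow> hbar2 C u v"
  unfolding form_polarization[OF approx_seqD(1)[OF a(1)] approx_seqD(1)[OF a(2)]] hbar2_def
  by (intro tendsto_intros hform_tendsto_hbar approx_seq_combine a L2_add L2_diff L2) auto

lemma approx_seq_const:
  assumes "g \<in> Cc_inf" shows "approx_seq C (\<lambda>k. g) g"
  using assms by (auto simp: approx_seq_def L2_dist2_def hform_def partial_const)

text \<open>Positivity of C at \<sigma> grad f - f grad \<sigma> absorbs the mixed terms, as in (a +
  b)^2 <= 2 a^2 + 2 b^2. Hence a bounded weight of bounded energy density maps approximating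
  sequences to approximating sequences.\<close>

lemma hform_mult_le:
  assumes f: "f \<in> Cc_inf" and \<sigma>: "smooth \<sigma>" "\<And>x. \<bar>\<sigma> x\<bar> \<le> M" "AE x in lborel. \<Gamma> \<sigma> \<sigma> x \<le> c"
  shows "hform C (\<lambda>x. \<sigma> x * f x) \<le> 2 * M\<^sup>2 * hform C f + 2 * c * (\<integral>x. (f x)\<^sup>2 \<partial>lborel)"
proof -
  note s = Cc_inf_smooth[OF f]
  have f2: "integrable lborel (\<lambda>x. (f x)\<^sup>2)" using Cc_inf_L2[OF f] by (simp add: L2_def)
  have "hform C (\<lambda>x. \<sigma> x * f x) \<le> (\<integral>x. 2 * M\<^sup>2 * \<Gamma> f f x + 2 * c * (f x)\<^sup>2 \<partial>lborel)"
    unfolding hform_eq form_def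
  proof (rule integral_mono_AE)
    show "integrable lborel (\<Gamma> (\<lambda>x. \<sigma> x * f x) (\<lambda>x. \<sigma> x * f x))"
      by (intro \<Gamma>_integrable Cc_inf_mult f \<sigma>)
    show "integrable lborel (\<lambda>x. 2 * M\<^sup>2 * \<Gamma> f f x + 2 * c * (f x)\<^sup>2)"
      using \<Gamma>_integrable[OF f f] f2 by simp
    show "AE x in lborel. \<Gamma> (\<lambda>x. \<sigma> x * f x) (\<lambda>x. \<sigma> x * f x) x \<le> 2 * M\<^sup>2 * \<Gamma> f f x + 2 * c * (f x)\<^sup>2"
      using C_psd \<sigma>(3)
    proof eventually_elim
      case (elim x)
      let ?a = "grad f x" and ?r = "grad \<sigma> x"
      have "0 \<le> (\<sigma> x *\<^sub>R ?a - f x *\<^sub>R ?r) \<bullet> (C x *v (\<sigma> x *\<^sub>R ?a - f x *\<^sub>R ?r))"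
        using elim by blast
      then have "\<Gamma> (\<lambda>x. \<sigma> x * f x) (\<lambda>x. \<sigma> x * f x) x \<le> 2 * ((\<sigma> x)\<^sup>2 * \<Gamma> f f x) + 2 * ((f x)\<^sup>2 * \<Gamma> \<sigma> \<sigma> x)"
        unfolding \<Gamma>_def grad_mult[OF \<sigma>(1) s]
        using C_inner_commute[of ?a x ?r]
        by (simp add: inner_add_left inner_add_right inner_diff_left inner_diff_right power2_eq_square
              matrix_vector_right_distrib matrix_vector_mult_diff_distrib matrix_vector_mult_scaleR algebra_simps)
      moreover have "(\<sigma> x)\<^sup>2 * \<Gamma> f f x \<le> M\<^sup>2 * \<Gamma> f f x"
      proof (rule mult_right_mono)
        show "(\<sigma> x)\<^sup>2 \<le> M\<^sup>2" using \<sigma>(2)[of x] by (metis abs_ge_zero power2_abs power_mono)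
      qed (use elim in \<open>simp add: \<Gamma>_def\<close>)
      moreover have "(f x)\<^sup>2 * \<Gamma> \<sigma> \<sigma> x \<le> (f x)\<^sup>2 * c" using elim by (intro mult_left_mono) auto
      ultimately show ?case by (simp add: algebra_simps)
    qed
  qed
  also have "\<dots> = 2 * M\<^sup>2 * hform C f + 2 * c * (\<integral>x. (f x)\<^sup>2 \<partial>lborel)"
    using \<Gamma>_integrable[OF f f] f2 by (simp add: hform_eq form_def)
  finally show ?thesis .
qed

lemma approx_seq_mult:
  assumes a: "approx_seq C \<phi> u" and u: "u \<in> L2"
    and \<sigma>: "smooth \<sigma>" "\<And>x. \<bar>\<sigma> x\<bar> \<le> M" "AE x in lborel. \<Gamma> \<sigma> \<sigma> x \<le> c"
  shows "approx_seq C (\<lambda>k x. \<sigma> x * \<phi> k x) (\<lambda>x. \<sigma> x * u x)"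
  unfolding approx_seq_def
proof (intro conjI allI impI)
  note \<phi> = approx_seqD[OF a]
  show "(\<lambda>x. \<sigma> x * \<phi> k x) \<in> Cc_inf" for k by (intro Cc_inf_mult \<phi> \<sigma>)
  have z: "(\<lambda>k. M\<^sup>2 * L2_dist2 (\<phi> k) u) \<longlonglongrightarrow> 0" by (rule tendsto_mult_right_zero[OF \<phi>(2)])
  show "(\<lambda>k. L2_dist2 (\<lambda>x. \<sigma> x * \<phi> k x) (\<lambda>x. \<sigma> x * u x)) \<longlonglongrightarrow> 0"
    by (rule tendsto_sandwich[OF _ _ tendsto_const z])
       (auto simp: L2_dist2_nonneg intro!: always_eventually L2_dist2_bounded_mult
          smooth_measurable Cc_inf_L2 \<phi> u \<sigma>)
  fix e :: real assume e: "e > 0"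
  \<comment> \<open>The two thresholds make each summand of the final estimate e/2. Adding 1 keeps
    the denominators positive; the 16 contains a factor 4 because two members are compared through
    their common limit in the squared distance.\<close>
  define d where "d = e / (4 * (M\<^sup>2 + 1))"
  define d' where "d' = e / (16 * (\<bar>c\<bar> + 1))"
  have d: "d > 0" "d' > 0" using e by (auto simp: d_def d'_def add_nonneg_pos)
  obtain N1 where N1: "\<forall>k\<ge>N1. \<forall>l\<ge>N1. hform C (\<lambda>x. \<phi> k x - \<phi> l x) < d" using \<phi>(3)[OF d(1)] by blast
  obtain N2 where N2: "\<forall>k\<ge>N2. L2_dist2 (\<phi> k) u < d'"
    using order_tendstoD(2)[OF \<phi>(2) d(2)] by (auto simp: eventually_sequentially)
  have "hform C (\<lambda>x. \<sigma> x * \<phi> k x - \<sigma> x * \<phi> l x) < e" if k: "k \<ge> max N1 N2" and l: "l \<ge> max N1 N2" for k l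
  proof -
    have "hform C (\<lambda>x. \<sigma> x * \<phi> k x - \<sigma> x * \<phi> l x) = hform C (\<lambda>x. \<sigma> x * (\<phi> k x - \<phi> l x))"
      by (simp add: right_diff_distrib)
    also have "\<dots> \<le> 2 * M\<^sup>2 * hform C (\<lambda>x. \<phi> k x - \<phi> l x) + 2 * c * (\<integral>x. (\<phi> k x - \<phi> l x)\<^sup>2 \<partial>lborel)"
      by (intro hform_mult_le Cc_inf_diff \<phi> \<sigma>)
    also have "\<dots> = 2 * M\<^sup>2 * hform C (\<lambda>x. \<phi> k x - \<phi> l x) + 2 * c * L2_dist2 (\<phi> k) (\<phi> l)"
      by (simp add: L2_dist2_def)
    also have "\<dots> \<le> 2 * (M\<^sup>2 + 1) * hform C (\<lambda>x. \<phi> k x - \<phi> l x) + 2 * (\<bar>c\<bar> + 1) * L2_dist2 (\<phi> k) (\<phi> l)"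
      by (intro add_mono mult_right_mono hform_nonneg L2_dist2_nonneg) auto
    also have "\<dots> < 2 * (M\<^sup>2 + 1) * d + 2 * (\<bar>c\<bar> + 1) * (4 * d')"
    proof (rule add_strict_mono)
      show "2 * (M\<^sup>2 + 1) * hform C (\<lambda>x. \<phi> k x - \<phi> l x) < 2 * (M\<^sup>2 + 1) * d"
        using N1 k l by (intro mult_strict_left_mono) (auto intro: add_nonneg_pos)
      have "L2_dist2 (\<phi> k) (\<phi> l) \<le> 2 * L2_dist2 (\<phi> k) u + 2 * L2_dist2 u (\<phi> l)"
        by (intro L2_dist2_triangle Cc_inf_L2 \<phi> u)
      then have "L2_dist2 (\<phi> k) (\<phi> l) < 4 * d'"
        using N2[rule_format, of k] N2[rule_format, of l] k l L2_dist2_commute[of u "\<phi> l"] by simp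
      then show "2 * (\<bar>c\<bar> + 1) * L2_dist2 (\<phi> k) (\<phi> l) < 2 * (\<bar>c\<bar> + 1) * (4 * d')"
        by (intro mult_strict_left_mono) auto
    qed
    also have "\<dots> = e / 2 + e / 2"
    proof -
      have "2 * A * (e / (4 * A)) = e / 2" "2 * A * (4 * (e / (16 * A))) = e / 2" if "A > 0" for A
        using that by (simp_all add: field_simps)
      note X = this
      have A: "M\<^sup>2 + 1 > 0" "\<bar>c\<bar> + 1 > 0" using zero_le_power2[of M] abs_ge_zero[of c] by linarith+
      show ?thesis unfolding d_def d'_def by (simp only: X(1)[OF A(1)] X(2)[OF A(2)])
    qed
    finally show ?thesis by simp
  qed
  then show "\<exists>N. \<forall>k\<ge>N. \<forall>l\<ge>N. hform C (\<lambda>x. \<sigma> x * \<phi> k x - \<sigma> x * \<phi> l x) < e" by blast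
qed

section \<open>The weighted energy estimate\<close>

text \<open>Expand \<open>\<Gamma>(\<zeta> + g, \<sigma> \<zeta>)\<close> and absorb the three mixed terms into \<open>\<sigma> \<Gamma>(\<zeta>, \<zeta>)\<close> by completing squares.\<close>

lemma weighted_energy_pointwise:
  assumes psd: "\<And>\<xi>. 0 \<le> \<xi> \<bullet> (C x *v \<xi>)" and s: "0 < s" and r: "r \<bullet> (C x *v r) \<le> c * s\<^sup>2"
  shows "- (2 * c * (s * z\<^sup>2)) - 2 * (s * (d \<bullet> (C x *v d))) \<le> (a + d) \<bullet> (C x *v (s *\<^sub>R a + z *\<^sub>R r))"
proof -
  define B where "B \<xi> \<eta> = \<xi> \<bullet> (C x *v \<eta>)" for \<xi> \<eta>
  have comm: "B \<xi> \<eta> = B \<eta> \<xi>" for \<xi> \<eta> unfolding B_def by (rule C_inner_commute)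
  have lin: "B (\<xi> + \<xi>') \<eta> = B \<xi> \<eta> + B \<xi>' \<eta>" "B (t *\<^sub>R \<xi>) \<eta> = t * B \<xi> \<eta>"
    "B \<eta> (\<xi> + \<xi>') = B \<eta> \<xi> + B \<eta> \<xi>'" "B \<eta> (t *\<^sub>R \<xi>) = t * B \<eta> \<xi>" for \<xi> \<xi>' \<eta> t
    by (simp_all add: B_def inner_add_left inner_add_right matrix_vector_right_distrib matrix_vector_mult_scaleR)
  have pos: "0 \<le> B \<xi> \<xi>" for \<xi> unfolding B_def by (rule psd)
  have r': "z\<^sup>2 * B r r \<le> z\<^sup>2 * (c * s\<^sup>2)" using r unfolding B_def by (intro mult_left_mono) auto
  \<comment> \<open>The square of (s/2) v + z r, divided by s, with the bound on r absorbing z^2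
    B(r, r). It is used for v = a and for v = d.\<close>
  have 1: "- (s / 4 * B v v) - c * (s * z\<^sup>2) \<le> z * B v r" for v
  proof -
    have "0 \<le> B ((s/2) *\<^sub>R v + z *\<^sub>R r) ((s/2) *\<^sub>R v + z *\<^sub>R r)" by (rule pos)
    also have "\<dots> = s\<^sup>2 / 4 * B v v + s * (z * B v r) + z\<^sup>2 * B r r"
      using comm[of r v] by (simp add: lin power2_eq_square algebra_simps)
    finally have "0 \<le> s * (s / 4 * B v v + z * B v r + c * (s * z\<^sup>2))"
      using r' by (simp add: power2_eq_square algebra_simps)
    then have "0 \<le> s / 4 * B v v + z * B v r + c * (s * z\<^sup>2)" using s by (simp add: zero_le_mult_iff)
    then show ?thesis by linarith
  qed
  have 2: "- (1 / 4 * B a a) - B d d \<le> B d a"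
  proof -
    have "0 \<le> B ((1/2) *\<^sub>R a + d) ((1/2) *\<^sub>R a + d)" by (rule pos)
    also have "\<dots> = 1 / 4 * B a a + B d a + B d d" using comm[of a d] by (simp add: lin algebra_simps)
    finally show ?thesis by linarith
  qed
  have "s * (- (1 / 4 * B a a) - B d d) \<le> s * B d a" using 2 s by (intro mult_left_mono) auto
  then have 2: "- (s / 4 * B a a) - s * B d d \<le> s * B d a" by (simp add: algebra_simps)
  \<comment> \<open>Budget: s B(a, a) loses two quarters to the squares, the d terms cost 5/4 of s
    B(d, d) out of the allowed 2, and the two z terms use exactly 2 c s z^2.\<close>
  have "0 \<le> s * B a a" "0 \<le> s * B d d" using s pos by auto
  moreover have "B (a + d) (s *\<^sub>R a + z *\<^sub>R r) = s * B a a + z * B a r + s * B d a + z * B d r"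
    by (simp add: lin algebra_simps)
  ultimately show ?thesis using 1[of a] 1[of d] 2 unfolding B_def[symmetric] by (simp add: algebra_simps)
qed

text \<open>The first part makes the weighted deviation a legitimate test element for
  \<open>H_graph\<close>. The second takes the limit of the integrated pointwise inequality along an
  approximating sequence of u from which g is subtracted, so the term with g is the same for every
  member.\<close>

lemma hbar2_weighted_lower_bound:
  assumes u: "u \<in> hdom C" and g: "g \<in> Cc_inf"
    and \<sigma>: "smooth \<sigma>" "\<And>x. 0 < \<sigma> x" "\<And>x. \<sigma> x \<le> 1" "AE x in lborel. \<Gamma> \<sigma> \<sigma> x \<le> c * (\<sigma> x)\<^sup>2" and c: "0 \<le> c"
  shows "(\<lambda>x. \<sigma> x * (u x - g x)) \<in> hdom C"
    and "- (2 * c * (\<integral>x. \<sigma> x * (u x - g x)\<^sup>2 \<partial>lborel)) - 2 * (\<integral>x. \<sigma> x * \<Gamma> g g x \<partial>lborel)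
      \<le> hbar2 C u (\<lambda>x. \<sigma> x * (u x - g x))"
proof -
  from u obtain \<phi> where L2: "u \<in> L2" and a: "approx_seq C \<phi> u" by (auto simp: hdom_def)
  note \<phi> = approx_seqD[OF a]
  have ab: "\<bar>\<sigma> x\<bar> \<le> 1" for x using \<sigma>(2,3)[of x] by simp
  have gL: "g \<in> L2" by (rule Cc_inf_L2[OF g])
  have zL: "(\<lambda>x. u x - g x) \<in> L2" by (intro L2_diff L2 gL)
  have szL: "(\<lambda>x. \<sigma> x * (u x - g x)) \<in> L2"
    using L2_bounded_mult[OF zL smooth_measurable[OF \<sigma>(1)] ab] .
  have \<Gamma>c: "AE x in lborel. \<Gamma> \<sigma> \<sigma> x \<le> c" using \<sigma>(4)
  proof eventually_elim
    case (elim x)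
    have "(\<sigma> x)\<^sup>2 \<le> 1" using \<sigma>(2,3)[of x] by (simp add: power_le_one)
    then have "c * (\<sigma> x)\<^sup>2 \<le> c" using c mult_left_le by blast
    then show ?case using elim by simp
  qed
  have za: "approx_seq C (\<lambda>k x. \<phi> k x - g x) (\<lambda>x. u x - g x)"
    by (rule approx_seq_combine(2)[OF a approx_seq_const[OF g] L2 gL])
  have sza: "approx_seq C (\<lambda>k x. \<sigma> x * (\<phi> k x - g x)) (\<lambda>x. \<sigma> x * (u x - g x))"
    by (rule approx_seq_mult[OF za zL \<sigma>(1) ab \<Gamma>c])
  then show "(\<lambda>x. \<sigma> x * (u x - g x)) \<in> hdom C" using szL by (auto simp: hdom_def)
  have lim: "(\<lambda>k. form (\<phi> k) (\<lambda>x. \<sigma> x * (\<phi> k x - g x))) \<longlonglongrightarrow> hbar2 C u (\<lambda>x. \<sigma> x * (u x - g x))"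
    by (rule form_tendsto_hbar2[OF a sza L2 szL])
  have inner: "(\<integral>x. \<sigma> x * (f x)\<^sup>2 \<partial>lborel) = L2_inner (\<lambda>x. \<sigma> x * f x) f" for f
    by (simp add: L2_inner_def power2_eq_square mult.assoc)
  have lim': "(\<lambda>k. \<integral>x. \<sigma> x * (\<phi> k x - g x)\<^sup>2 \<partial>lborel) \<longlonglongrightarrow> (\<integral>x. \<sigma> x * (u x - g x)\<^sup>2 \<partial>lborel)"
    unfolding inner
    by (rule L2_inner_tendsto)
       (use approx_seqD[OF za] approx_seqD[OF sza] szL zL in \<open>auto intro!: always_eventually Cc_inf_L2\<close>)
  have "- (2 * c * (\<integral>x. \<sigma> x * (\<phi> k x - g x)\<^sup>2 \<partial>lborel)) - 2 * (\<integral>x. \<sigma> x * \<Gamma> g g x \<partial>lborel)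
      \<le> form (\<phi> k) (\<lambda>x. \<sigma> x * (\<phi> k x - g x))" for k
  proof -
    let ?z = "\<lambda>x. \<phi> k x - g x"
    have z: "?z \<in> Cc_inf" by (intro Cc_inf_diff \<phi> g)
    have i1: "integrable lborel (\<lambda>x. \<sigma> x * (?z x)\<^sup>2)"
      using L2_integrable_mult[OF Cc_inf_L2[OF Cc_inf_mult[OF z \<sigma>(1)]] Cc_inf_L2[OF z]]
      by (simp add: power2_eq_square mult.assoc)
    have i2: "integrable lborel (\<lambda>x. \<sigma> x * \<Gamma> g g x)" by (intro \<Gamma>_integrable_weighted g \<sigma>)
    have "- (2 * c * (\<integral>x. \<sigma> x * (?z x)\<^sup>2 \<partial>lborel)) - 2 * (\<integral>x. \<sigma> x * \<Gamma> g g x \<partial>lborel)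
       = (\<integral>x. - (2 * c * (\<sigma> x * (?z x)\<^sup>2)) - 2 * (\<sigma> x * \<Gamma> g g x) \<partial>lborel)"
      using i1 i2 by simp
    also have "\<dots> \<le> form (\<phi> k) (\<lambda>x. \<sigma> x * ?z x)"
      unfolding form_def
    proof (rule integral_mono_AE)
      show "integrable lborel (\<lambda>x. - (2 * c * (\<sigma> x * (?z x)\<^sup>2)) - 2 * (\<sigma> x * \<Gamma> g g x))"
        using i1 i2 by simp
      show "integrable lborel (\<Gamma> (\<phi> k) (\<lambda>x. \<sigma> x * ?z x))"
        by (intro \<Gamma>_integrable Cc_inf_mult z \<phi> \<sigma>)
      show "AE x in lborel. - (2 * c * (\<sigma> x * (?z x)\<^sup>2)) - 2 * (\<sigma> x * \<Gamma> g g x) \<le> \<Gamma> (\<phi> k) (\<lambda>x. \<sigma> x * ?z x) x"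
        using C_psd \<sigma>(4)
      proof eventually_elim
        case (elim x)
        have eq: "grad (\<phi> k) x = grad ?z x + grad g x"
          using grad_add[OF Cc_inf_smooth[OF z] Cc_inf_smooth[OF g], of x] by simp
        show ?case
          unfolding \<Gamma>_def grad_mult[OF \<sigma>(1) Cc_inf_smooth[OF z]] eq
          by (rule weighted_energy_pointwise) (use elim \<sigma>(2) in \<open>auto simp: \<Gamma>_def\<close>)
      qed
    qed
    finally show ?thesis .
  qed
  then have ev: "\<forall>\<^sub>F k in sequentially. - (2 * c * (\<integral>x. \<sigma> x * (\<phi> k x - g x)\<^sup>2 \<partial>lborel)) - 2 * (\<integral>x. \<sigma> x * \<Gamma> g g x \<partial>lborel)
      \<le> form (\<phi> k) (\<lambda>x. \<sigma> x * (\<phi> k x - g x))" by (intro always_eventually allI)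
  show "- (2 * c * (\<integral>x. \<sigma> x * (u x - g x)\<^sup>2 \<partial>lborel)) - 2 * (\<integral>x. \<sigma> x * \<Gamma> g g x \<partial>lborel)
      \<le> hbar2 C u (\<lambda>x. \<sigma> x * (u x - g x))"
    by (rule tendsto_le[OF _ lim _ ev]) (auto intro!: tendsto_intros lim')
qed

text \<open>\<open>S\<close> is differentiable only in the \<open>L2\<close> sense and only at
  positive times. The derivative of the weighted deviation is therefore the limit of inner products
  with difference quotients, and continuity at time 0 is supplied separately for the Gronwall
  argument.\<close>

lemma semigroup_weighted_deviation:
  assumes S: "is_semigroup_of C S" and g: "g \<in> Cc_inf" and t: "0 \<le> t"
    and \<sigma>: "smooth \<sigma>" "\<And>x. 0 < \<sigma> x" "\<And>x. \<sigma> x \<le> 1" "AE x in lborel. \<Gamma> \<sigma> \<sigma> x \<le> c * (\<sigma> x)\<^sup>2" and c: "0 \<le> c"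
  shows "(\<integral>x. \<sigma> x * (S t g x - g x)\<^sup>2 \<partial>lborel) \<le> exp (4 * c * t) * (4 * t * (\<integral>x. \<sigma> x * \<Gamma> g g x \<partial>lborel))"
proof -
  define \<eta> where "\<eta> = (\<integral>x. \<sigma> x * \<Gamma> g g x \<partial>lborel)"
  have \<eta>: "0 \<le> \<eta>" unfolding \<eta>_def
    by (rule integral_nonneg_AE) (use \<Gamma>_nonneg[of g] in eventually_elim, use \<sigma>(2) in \<open>simp add: less_imp_le\<close>)
  have ab: "\<bar>\<sigma> x\<bar> \<le> 1" for x using \<sigma>(2,3)[of x] by simp
  have gL: "g \<in> L2" by (rule Cc_inf_L2[OF g])
  define z where "z s x = S s g x - g x" for s x
  define G where "G s = (\<integral>x. \<sigma> x * (z s x)\<^sup>2 \<partial>lborel)" for s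
  have G_inner: "G s = L2_inner (z s) (\<lambda>x. \<sigma> x * z s x)" for s
    by (simp add: G_def L2_inner_def power2_eq_square algebra_simps)
  have SL: "S s g \<in> L2" if "s \<ge> 0" for s using S gL that by (auto simp: is_semigroup_of_def)
  have zL: "z s \<in> L2" if "s \<ge> 0" for s unfolding z_def[abs_def] by (intro L2_diff SL that gL)
  have mL: "(\<lambda>x. \<sigma> x * f x) \<in> L2" if "f \<in> L2" for f
    using L2_bounded_mult[OF that smooth_measurable[OF \<sigma>(1)] ab] .
  have md: "L2_dist2 (\<lambda>x. \<sigma> x * f x) (\<lambda>x. \<sigma> x * f' x) \<le> L2_dist2 f f'" if "f \<in> L2" "f' \<in> L2" for f f'
    using L2_dist2_bounded_mult[OF that smooth_measurable[OF \<sigma>(1)] ab] by simp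
  have z_cont: "((\<lambda>s. L2_dist2 (z s) (z s0)) \<longlongrightarrow> 0) (at s0 within {0..})" if "s0 \<ge> 0" for s0
    using S gL that by (auto simp: is_semigroup_of_def L2_dist2_def z_def)
  have nonneg_ev: "\<forall>\<^sub>F s in at s0 within {0..}. 0 \<le> s" for s0 :: real
    by (auto simp: eventually_at_filter)
  have G_cont: "continuous_on {0..t} G"
  proof -
    have "(G \<longlongrightarrow> G s0) (at s0 within {0..})" if s0: "s0 \<ge> 0" for s0
      unfolding G_inner
    proof (rule L2_inner_tendsto)
      show "((\<lambda>s. L2_dist2 (z s) (z s0)) \<longlongrightarrow> 0) (at s0 within {0..})" by (rule z_cont[OF s0])
      show "((\<lambda>s. L2_dist2 (\<lambda>x. \<sigma> x * z s x) (\<lambda>x. \<sigma> x * z s0 x)) \<longlongrightarrow> 0) (at s0 within {0..})"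
      proof (rule tendsto_sandwich[OF _ _ tendsto_const z_cont[OF s0]])
        show "\<forall>\<^sub>F s in at s0 within {0..}. L2_dist2 (\<lambda>x. \<sigma> x * z s x) (\<lambda>x. \<sigma> x * z s0 x) \<le> L2_dist2 (z s) (z s0)"
          using nonneg_ev by eventually_elim (intro md zL s0)
      qed (auto simp: L2_dist2_nonneg)
      show "\<forall>\<^sub>F s in at s0 within {0..}. z s \<in> L2" using nonneg_ev by eventually_elim (rule zL)
      show "\<forall>\<^sub>F s in at s0 within {0..}. (\<lambda>x. \<sigma> x * z s x) \<in> L2"
        using nonneg_ev by eventually_elim (intro mL zL)
    qed (intro mL zL s0)+
    then have "continuous_on {0..} G" by (auto simp: continuous_on_def)
    then show ?thesis by (rule continuous_on_subset) auto
  qed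
  have G_deriv: "\<exists>D. DERIV G s :> D \<and> D \<le> 4 * c * G s + 4 * \<eta>" if s: "s > 0" for s
  proof -
    define q where "q h x = (S (s + h) g x - S s g x) / h" for h x
    obtain f where H: "H_graph C (S s g) f" and lim: "((\<lambda>h. L2_dist2 (q h) (\<lambda>x. - f x)) \<longlongrightarrow> 0) (at 0)"
      using S gL s unfolding is_semigroup_of_def q_def[abs_def] by blast
    have fL: "f \<in> L2" and u: "S s g \<in> hdom C" using H by (auto simp: H_graph_def)
    have nfL: "(\<lambda>x. - f x) \<in> L2" using L2_cmult[OF fL, of "-1"] by simp
    note lb = hbar2_weighted_lower_bound[OF u g \<sigma> c]
    have "hbar2 C (S s g) (\<lambda>x. \<sigma> x * z s x) = L2_inner f (\<lambda>x. \<sigma> x * z s x)"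
      using H lb(1) by (auto simp: H_graph_def z_def)
    then have lb': "- (2 * c * G s) - 2 * \<eta> \<le> L2_inner f (\<lambda>x. \<sigma> x * z s x)"
      using lb(2) by (simp add: G_def z_def \<eta>_def)
    \<comment> \<open>Membership of the semigroup in \<open>L2\<close> is known at nonnegative
      times; s > 0 leaves room for h of either sign.\<close>
    have pos_ev: "\<forall>\<^sub>F h in at 0. 0 \<le> s + h \<and> h \<noteq> 0"
    proof -
      have "\<forall>\<^sub>F h in at 0. h \<in> {-s<..<s} - {0}"
        using s by (intro eventually_at_in_open) auto
      then show ?thesis by eventually_elim auto
    qed
    have z_cont0: "((\<lambda>h. L2_dist2 (z (s + h)) (z s)) \<longlongrightarrow> 0) (at 0)"
    proof -
      have "((\<lambda>s'. L2_dist2 (z s') (z s)) \<longlongrightarrow> 0) (at s)"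
        using z_cont[of s] s at_within_interior[OF interiorI[of "{0<..}" s "{0..}"]] by (auto simp: less_imp_le subset_eq)
      then show ?thesis by (rule LIM_offset_zero)
    qed
    \<comment> \<open>By a^2 - b^2 = (a - b) (a + b), this inner product is the difference quotient
      of \<open>G\<close>, shown further down; the limit is -2 (f, \<sigma> z).\<close>
    have "((\<lambda>h. L2_inner (q h) (\<lambda>x. \<sigma> x * (z (s + h) x + z s x))) \<longlongrightarrow>
        L2_inner (\<lambda>x. - f x) (\<lambda>x. \<sigma> x * (z s x + z s x))) (at 0)"
    proof (rule L2_inner_tendsto[OF _ nfL lim])
      show "\<forall>\<^sub>F h in at 0. q h \<in> L2" using pos_ev
      proof eventually_elim
        case (elim h)
        then show ?case using L2_cmult[OF L2_diff[OF SL SL], of "s + h" s "1 / h"] s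
          by (simp add: q_def[abs_def])
      qed
      show "(\<lambda>x. \<sigma> x * (z s x + z s x)) \<in> L2" using s by (intro mL L2_add zL) auto
      show "\<forall>\<^sub>F h in at 0. (\<lambda>x. \<sigma> x * (z (s + h) x + z s x)) \<in> L2"
        using pos_ev by eventually_elim (use s in \<open>intro mL L2_add zL, auto\<close>)
      show "((\<lambda>h. L2_dist2 (\<lambda>x. \<sigma> x * (z (s + h) x + z s x)) (\<lambda>x. \<sigma> x * (z s x + z s x))) \<longlongrightarrow> 0) (at 0)"
      proof (rule tendsto_sandwich[OF _ _ tendsto_const z_cont0])
        show "\<forall>\<^sub>F h in at 0. L2_dist2 (\<lambda>x. \<sigma> x * (z (s + h) x + z s x)) (\<lambda>x. \<sigma> x * (z s x + z s x)) \<le> L2_dist2 (z (s + h)) (z s)"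
          using pos_ev
        proof eventually_elim
          case (elim h)
          have "L2_dist2 (\<lambda>x. \<sigma> x * (z (s + h) x + z s x)) (\<lambda>x. \<sigma> x * (z s x + z s x))
             \<le> L2_dist2 (\<lambda>x. z (s + h) x + z s x) (\<lambda>x. z s x + z s x)"
            using elim s by (intro md L2_add zL) auto
          then show ?case by (simp add: L2_dist2_def)
        qed
      qed (auto simp: L2_dist2_nonneg)
    qed
    moreover have "L2_inner (\<lambda>x. - f x) (\<lambda>x. \<sigma> x * (z s x + z s x)) = - 2 * L2_inner f (\<lambda>x. \<sigma> x * z s x)"
      by (simp add: L2_inner_def algebra_simps flip: Bochner_Integration.integral_mult_right_zero)
    ultimately have "((\<lambda>h. L2_inner (q h) (\<lambda>x. \<sigma> x * (z (s + h) x + z s x))) \<longlongrightarrow>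
        - 2 * L2_inner f (\<lambda>x. \<sigma> x * z s x)) (at 0)" by simp
    moreover have "\<forall>\<^sub>F h in at 0. L2_inner (q h) (\<lambda>x. \<sigma> x * (z (s + h) x + z s x)) = (G (s + h) - G s) / h"
      using pos_ev
    proof eventually_elim
      case (elim h)
      have i: "integrable lborel (\<lambda>x. \<sigma> x * (z r x)\<^sup>2)" if "r \<ge> 0" for r
        using L2_integrable_mult[OF mL[OF zL[OF that]] zL[OF that]] by (simp add: power2_eq_square mult.assoc)
      have "G (s + h) - G s = (\<integral>x. \<sigma> x * (z (s + h) x)\<^sup>2 - \<sigma> x * (z s x)\<^sup>2 \<partial>lborel)"
        using elim s i[of s] i[of "s + h"] by (simp add: G_def)
      also have "\<dots> = (\<integral>x. h * (q h x * (\<sigma> x * (z (s + h) x + z s x))) \<partial>lborel)"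
      proof (rule Bochner_Integration.integral_cong[OF refl])
        fix x
        have "h * q h x = z (s + h) x - z s x" using elim by (simp add: q_def z_def)
        then have "h * (q h x * (\<sigma> x * (z (s + h) x + z s x))) = (z (s + h) x - z s x) * (\<sigma> x * (z (s + h) x + z s x))"
          by (simp only: mult.assoc[symmetric])
        then show "\<sigma> x * (z (s + h) x)\<^sup>2 - \<sigma> x * (z s x)\<^sup>2 = h * (q h x * (\<sigma> x * (z (s + h) x + z s x)))"
          by (simp add: power2_eq_square algebra_simps)
      qed
      also have "\<dots> = h * L2_inner (q h) (\<lambda>x. \<sigma> x * (z (s + h) x + z s x))"
        by (simp add: L2_inner_def)
      finally show ?case using elim by simp
    qed
    ultimately have "DERIV G s :> - 2 * L2_inner f (\<lambda>x. \<sigma> x * z s x)"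
      unfolding DERIV_def by (rule Lim_transform_eventually)
    then show ?thesis using lb' by (intro exI conjI) auto
  qed
  \<comment> \<open>Integrating factor for G' <= 4 c G + 4 \<eta>. Since exp(-4 c s) <= 1, the
    inhomogeneous part is bounded by 4 \<eta>, and subtracting the linear term makes
    \<open>F\<close> nonincreasing.\<close>
  define F where "F s = exp (- 4 * c * s) * G s - 4 * \<eta> * s" for s
  have "F 0 \<ge> F t"
  proof (rule DERIV_nonpos_imp_decreasing_open[OF t])
    show "continuous_on {0..t} F" unfolding F_def by (intro continuous_intros G_cont)
    fix s assume s: "0 < s" "s < t"
    obtain D where D: "DERIV G s :> D" "D \<le> 4 * c * G s + 4 * \<eta>" using G_deriv[OF s(1)] by blast
    have "DERIV F s :> exp (- 4 * c * s) * (D - 4 * c * G s) - 4 * \<eta>"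
      unfolding F_def by (auto intro!: derivative_eq_intros D(1) simp: algebra_simps)
    have "exp (- 4 * c * s) * (D - 4 * c * G s) \<le> exp (- 4 * c * s) * (4 * \<eta>)"
      using D(2) by (intro mult_left_mono) auto
    moreover have "exp (- 4 * c * s) * (4 * \<eta>) \<le> 1 * (4 * \<eta>)"
      using s c \<eta> by (intro mult_right_mono) auto
    ultimately have "exp (- 4 * c * s) * (D - 4 * c * G s) - 4 * \<eta> \<le> 0" by linarith
    with \<open>DERIV F s :> _\<close> show "\<exists>y. DERIV F s :> y \<and> y \<le> 0" by blast
  qed
  \<comment> \<open>\<open>S 0 g\<close> agrees with g only up to \<open>L2\<close> distance 0, so
    the weighted integral vanishes through almost everywhere equality.\<close>
  moreover have "G 0 = 0"
  proof -
    have "(\<integral>x. (z 0 x)\<^sup>2 \<partial>lborel) = 0"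
      using S gL by (auto simp: is_semigroup_of_def L2_dist2_def z_def)
    moreover have "integrable lborel (\<lambda>x. (z 0 x)\<^sup>2)" using zL[of 0] by (simp add: L2_def)
    ultimately have "AE x in lborel. (z 0 x)\<^sup>2 = 0" using integral_nonneg_eq_0_iff_AE[of lborel "\<lambda>x. (z 0 x)\<^sup>2"] by simp
    then show ?thesis unfolding G_def by (intro integral_eq_zero_AE) auto
  qed
  ultimately have "exp (- 4 * c * t) * G t \<le> 4 * \<eta> * t" by (simp add: F_def)
  then have "exp (4 * c * t) * (exp (- 4 * c * t) * G t) \<le> exp (4 * c * t) * (4 * \<eta> * t)"
    by (intro mult_left_mono) auto
  moreover have "exp (4 * c * t) * (exp (- 4 * c * t) * G t) = G t"
    by (simp add: mult.assoc[symmetric] flip: exp_add)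
  ultimately have "G t \<le> exp (4 * c * t) * (4 * t * \<eta>)" by (simp only: mult.assoc mult.commute[of \<eta> t])
  then show ?thesis by (simp only: G_def z_def \<eta>_def)
qed

end

section \<open>Conservation of mass\<close>

lemma integrable_inverse_one_plus_square: "integrable lborel (\<lambda>x::real. inverse (1 + x\<^sup>2))"
  using integrable_inverse_1_plus_square by (simp add: set_integrable_def)

text \<open>Since 1 + |x|^2 >= 1 + (x . b)^2 for each basis vector b, the product over the
  \<open>CARD('k)\<close> coordinates is a majorant, and its integral factors into finite
  one-variable integrals.\<close>

lemma integrable_inverse_power_norm:
  "integrable lborel (\<lambda>x::real^'k::finite. inverse (1 + x \<bullet> x) ^ CARD('k))"
proof (rule Bochner_Integration.integrable_bound)
  let ?f = "\<lambda>y::real. inverse (1 + y\<^sup>2)"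
  let ?p = "\<lambda>x::real^'k. \<Prod>b\<in>Basis. ?f (x \<bullet> b)"
  have pos: "0 \<le> ?f y" for y by simp
  have fin: "(\<integral>\<^sup>+y. ennreal (?f y) \<partial>lborel) < \<infinity>"
    using integrable_inverse_one_plus_square by (simp add: integrable_iff_bounded)
  have "(\<integral>\<^sup>+x. ennreal (?p x) \<partial>lborel) = (\<integral>\<^sup>+x. (\<Prod>b\<in>(Basis::(real^'k) set). ennreal (?f (x \<bullet> b))) \<partial>lborel)"
    by (simp add: prod_ennreal)
  also have "\<dots> = (\<Prod>b\<in>(Basis::(real^'k) set). \<integral>\<^sup>+y. ennreal (?f y) \<partial>lborel)"
    by (rule nn_integral_lborel_prod) auto
  also have "\<dots> < \<infinity>" using fin by (simp add: power_less_top_ennreal)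
  finally show "integrable lborel ?p"
    by (intro integrableI_nonneg) (auto intro!: AE_I2 prod_nonneg)
  show "AE x in lborel. norm (inverse (1 + x \<bullet> x) ^ CARD('k)) \<le> norm (?p x)"
  proof (rule AE_I2)
    fix x :: "real^'k"
    have "(\<Prod>b\<in>(Basis::(real^'k) set). inverse (1 + x \<bullet> x)) \<le> ?p x"
    proof (rule prod_mono)
      fix b :: "real^'k" assume b: "b \<in> Basis"
      have "(x \<bullet> b)\<^sup>2 \<le> x \<bullet> x"
        using Basis_le_norm[OF b, of x] by (metis abs_ge_zero power2_abs power2_norm_eq_inner power_mono)
      then show "0 \<le> inverse (1 + x \<bullet> x) \<and> inverse (1 + x \<bullet> x) \<le> ?f (x \<bullet> b)"
        by (auto intro!: le_imp_inverse_le add_pos_nonneg)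
    qed
    then show "norm (inverse (1 + x \<bullet> x) ^ CARD('k)) \<le> norm (?p x)" by simp
  qed
qed simp

text \<open>The limit exists along a subsequence only; monotonicity in \<open>n\<close> upgrades it, and at the same
  time rules out that the integral is the junk value 0 of a non-integrable function.\<close>

lemma kernel_mass_eq_1:
  fixes k :: "'a \<Rightarrow> real"
  assumes [measurable]: "k \<in> borel_measurable M" "\<And>n. g n \<in> borel_measurable M"
    and nonneg: "\<And>y. 0 \<le> k y" "\<And>n y. 0 \<le> g n y"
    and mono: "\<And>y. incseq (\<lambda>n. g n y)" and lim: "\<And>y. (\<lambda>n. g n y) \<longlonglongrightarrow> (1::real)"
    and r: "strict_mono r" and sub: "(\<lambda>n. \<integral>y. k y * g (r n) y \<partial>M) \<longlonglongrightarrow> 1"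
  shows "(\<integral>\<^sup>+y. ennreal (k y) \<partial>M) = 1"
proof -
  define A where "A n = (\<integral>\<^sup>+y. ennreal (k y * g n y) \<partial>M)" for n
  have A_mono: "A m \<le> A n" if "m \<le> n" for m n
    unfolding A_def using that mono nonneg by (intro nn_integral_mono ennreal_leI mult_left_mono) (auto simp: incseq_def)
  have A_lim: "A \<longlonglongrightarrow> (\<integral>\<^sup>+y. ennreal (k y) \<partial>M)"
    unfolding A_def
  proof (rule nn_integral_LIMSEQ)
    show "incseq (\<lambda>n y. ennreal (k y * g n y))"
      using mono nonneg by (auto simp: incseq_def le_fun_def intro!: ennreal_leI mult_left_mono)
    show "(\<lambda>n. ennreal (k y * g n y)) \<longlonglongrightarrow> ennreal (k y)" for y
      using tendsto_mult[OF tendsto_const lim, of "k y"] by (intro tendsto_ennrealI) simp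
  qed simp
  have int: "(\<integral>y. k y * g n y \<partial>M) = enn2real (A n)" for n
    unfolding A_def by (rule integral_eq_nn_integral) (use nonneg in auto)
  \<comment> \<open>\<open>enn2real\<close> sends infinity to 0: by monotonicity an infinite
    \<open>A n\<close> would make all later real integrals 0, against their limit 1.\<close>
  have fin: "A n < \<infinity>" for n
  proof (rule ccontr)
    assume "\<not> A n < \<infinity>"
    then have "A (r m) = \<infinity>" if "m \<ge> n" for m
      using A_mono[of n "r m"] seq_suble[OF r, of m] that by (simp add: top.extremum_unique not_less)
    then have "\<forall>\<^sub>F m in sequentially. (\<integral>y. k y * g (r m) y \<partial>M) = 0"
      unfolding int eventually_sequentially by (intro exI[of _ n]) simp
    then have "(\<lambda>m. \<integral>y. k y * g (r m) y \<partial>M) \<longlonglongrightarrow> 0" by (rule tendsto_eventually)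
    then show False using LIMSEQ_unique[OF sub] by fastforce
  qed
  have "(\<lambda>n. A (r n)) \<longlonglongrightarrow> ennreal 1"
    using tendsto_ennrealI[OF sub] fin unfolding int by (simp add: less_top)
  moreover have "(\<lambda>n. A (r n)) \<longlonglongrightarrow> (\<integral>\<^sup>+y. ennreal (k y) \<partial>M)"
    using LIMSEQ_subseq_LIMSEQ[OF A_lim r] by (simp add: o_def)
  ultimately show ?thesis using LIMSEQ_unique by fastforce
qed

context degenerate_form
begin

lemma \<Gamma>_compose:
  assumes "smooth f" "(G has_real_derivative G') (at (f x))"
  shows "\<Gamma> (\<lambda>x. G (f x)) (\<lambda>x. G (f x)) x = G'\<^sup>2 * \<Gamma> f f x"
  unfolding \<Gamma>_def grad_compose[OF assms] by (simp add: matrix_vector_mult_scaleR power2_eq_square)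

text \<open>The bound on \<open>\<Gamma> P P\<close> says that log P has bounded energy density; P
  >= 1 + |x|^2 makes sublevel sets compact and high inverse powers integrable. Weight and cutoffs
  are both built from such a P.\<close>

lemma semigroup_kernel_conservative:
  assumes S: "is_semigroup_of C S"
    and K_nonneg: "\<And>x y. 0 \<le> K x y"
    and K_meas: "(\<lambda>(x, y). K x y) \<in> borel_measurable (lborel \<Otimes>\<^sub>M lborel)"
    and K_kernel: "\<And>\<phi>. \<phi> \<in> L2 \<Longrightarrow> AE x in lborel. S t \<phi> x = (\<integral>y. K x y * \<phi> y \<partial>lborel)"
    and t: "t > 0"
    and P: "smooth P" "\<And>x. 1 + x \<bullet> x \<le> P x" "AE x in lborel. \<Gamma> P P x \<le> b * (P x)\<^sup>2" and b: "0 \<le> b"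
  shows "AE x in lborel. (\<integral>\<^sup>+ y. ennreal (K x y) \<partial>lborel) = 1"
proof -
  have P1: "1 \<le> P x" for x using P(2)[of x] inner_ge_zero[of x] by linarith
  have Pnz: "P x \<noteq> 0" for x using P1[of x] by auto
  define N where "N = CARD('k)"
  \<comment> \<open>N powers make the weight integrable; the other two cancel the P^2 that appears
    in the energy of the cutoffs.\<close>
  define \<sigma> where "\<sigma> x = inverse (P x) ^ (N + 2)" for x
  have inv: "0 < inverse (P x)" "inverse (P x) \<le> 1" for x
    using P1[of x] by (auto simp: inverse_le_1_iff intro: less_le_trans[OF zero_less_one])
  have \<sigma>: "smooth \<sigma>" "\<And>x. 0 < \<sigma> x" "\<And>x. \<sigma> x \<le> 1"
    unfolding \<sigma>_def[abs_def]
    by (intro smooth_power smooth_inverse P Pnz, intro zero_less_power inv,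
        intro power_le_one inv less_imp_le)
  \<comment> \<open>The derivative of P^-(N+2) with respect to P is -(N + 2) P^-(N+3); its square
    times b P^2 is c times the square of \<sigma>.\<close>
  define c where "c = (real (N + 2))\<^sup>2 * b"
  have c: "0 \<le> c" using b by (simp add: c_def)
  have \<Gamma>\<sigma>: "AE x in lborel. \<Gamma> \<sigma> \<sigma> x \<le> c * (\<sigma> x)\<^sup>2"
    using P(3)
  proof eventually_elim
    case (elim x)
    let ?y = "inverse (P x)"
    have D: "((\<lambda>y. inverse y ^ (N + 2)) has_real_derivative - (real (N + 2) * ?y ^ (N + 3))) (at (P x))"
      using DERIV_power_Suc[OF DERIV_inverse[OF Pnz[of x]], of "N + 1"]
      by (simp add: power_add power3_eq_cube power2_eq_square algebra_simps)
    have "\<Gamma> \<sigma> \<sigma> x = (real (N + 2) * ?y ^ (N + 3))\<^sup>2 * \<Gamma> P P x"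
      using \<Gamma>_compose[OF P(1) D] by (simp add: \<sigma>_def[abs_def])
    also have "\<dots> \<le> (real (N + 2) * ?y ^ (N + 3))\<^sup>2 * (b * (P x)\<^sup>2)"
      using elim by (intro mult_left_mono) auto
    also have "?y ^ (N + 3) = ?y ^ (N + 2) * ?y" by (simp add: power_add power3_eq_cube power2_eq_square)
    also have "(real (N + 2) * (?y ^ (N + 2) * ?y))\<^sup>2 * (b * (P x)\<^sup>2) = c * (\<sigma> x)\<^sup>2 * (?y * P x)\<^sup>2"
      unfolding c_def \<sigma>_def power_mult_distrib by (simp only: ac_simps)
    finally show ?case using Pnz[of x] by simp
  qed
  have w_int: "integrable lborel (\<lambda>x. inverse (P x) ^ N)"
  proof (rule Bochner_Integration.integrable_bound[OF integrable_inverse_power_norm])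
    have "inverse (P x) ^ N \<le> inverse (1 + x \<bullet> x) ^ CARD('k)" for x
      unfolding N_def using P(2)[of x] less_imp_le[OF inv(1)]
      by (intro power_mono le_imp_inverse_le) (auto intro: add_pos_nonneg)
    then show "AE x in lborel. norm (inverse (P x) ^ N) \<le> norm (inverse (1 + x \<bullet> x) ^ CARD('k))"
      using less_imp_le[OF inv(1)] by (intro AE_I2) (simp add: power_abs)
  qed (use smooth_measurable[OF P(1)] in auto)
  have \<sigma>_int: "integrable lborel \<sigma>"
  proof (rule Bochner_Integration.integrable_bound[OF w_int])
    show "AE x in lborel. norm (\<sigma> x) \<le> norm (inverse (P x) ^ N)"
    proof (rule AE_I2)
      fix x
      have "inverse (P x) ^ (N + 2) \<le> inverse (P x) ^ N" using inv[of x] by (intro power_decreasing) auto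
      then show "norm (\<sigma> x) \<le> norm (inverse (P x) ^ N)"
        using inv[of x] by (simp add: \<sigma>_def power_abs)
    qed
  qed (use smooth_measurable[OF \<sigma>(1)] in auto)
  \<comment> \<open>The factor exp 1 normalizes the value exp(-1) of \<open>flat 1\<close> at 1. The
    argument is positive only where P < k + 1, a bounded set; \<open>Suc k\<close> keeps the
    division meaningful for k = 0.\<close>
  define g where "g k x = exp 1 * flat 1 (1 - P x * inverse (real (Suc k)))" for k x
  have g_smooth: "smooth (g k)" for k
    unfolding g_def[abs_def]
    by (intro smooth_mult smooth_const smooth_compose[OF smooth_flat] smooth_diff P)
  have g_Cc: "g k \<in> Cc_inf" for k
  proof (rule Cc_infI[OF g_smooth, of "cball 0 (sqrt (Suc k))"])
    fix x :: "real^'k" assume "x \<notin> cball 0 (sqrt (Suc k))"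
    then have "sqrt (Suc k) < norm x" by simp
    then have "(sqrt (Suc k))\<^sup>2 < (norm x)\<^sup>2" by (intro power_strict_mono) auto
    then have "real (Suc k) < P x" using P(2)[of x] by (simp add: power2_norm_eq_inner)
    then show "g k x = 0" by (simp add: g_def flat_def field_simps)
  qed auto
  have g_nonneg: "0 \<le> g k x" for k x using flat_nonneg by (simp add: g_def)
  have g_le_1: "g k x \<le> 1" for k x
  proof (cases "1 - P x * inverse (real (Suc k)) > 0")
    case True
    have "1 \<le> inverse (1 - P x * inverse (real (Suc k)))"
      using True P1[of x] by (intro one_le_inverse) auto
    then have "exp (1 - inverse (1 - P x * inverse (real (Suc k)))) \<le> exp 0" by (intro exp_le_cancel_iff[THEN iffD2]) simp
    then show ?thesis using True by (simp add: g_def flat_def flip: exp_add)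
  next
    case False
    then show ?thesis unfolding g_def flat_def by (simp only: if_False)
  qed
  have g_mono: "incseq (\<lambda>k. g k x)" for x
    unfolding incseq_def g_def using P1[of x]
    by (auto intro!: mult_left_mono monoD[OF mono_flat] le_imp_inverse_le)
  have g_lim: "(\<lambda>k. g k x) \<longlonglongrightarrow> 1" for x
  proof -
    have "(\<lambda>k. 1 - P x * inverse (real (Suc k))) \<longlonglongrightarrow> 1 - P x * 0"
      by (intro tendsto_intros LIMSEQ_inverse_real_of_nat)
    then have "(\<lambda>k. 1 - P x * inverse (real (Suc k))) \<longlonglongrightarrow> 1" by simp
    moreover have "isCont (flat 1) 1" using flat_1_has_derivative DERIV_isCont by blast
    ultimately have "(\<lambda>k. flat 1 (1 - P x * inverse (real (Suc k)))) \<longlonglongrightarrow> flat 1 1"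
      by (rule isCont_tendsto_compose[rotated])
    from tendsto_mult[OF tendsto_const this, of "exp 1"] show ?thesis
      by (simp add: g_def flat_def flip: exp_add)
  qed
  \<comment> \<open>16 is the square of the slope bound of \<open>flat 1\<close>, and the square of
    exp 1 comes from the normalization of the cutoffs.\<close>
  define B where "B = 16 * (exp 1)\<^sup>2 * b * (\<integral>x. inverse (P x) ^ N \<partial>lborel)"
  have energy: "(\<integral>x. \<sigma> x * \<Gamma> (g k) (g k) x \<partial>lborel) \<le> B * (inverse (real (Suc k)))\<^sup>2" for k
  proof -
    let ?h = "inverse (real (Suc k))"
    have "(\<integral>x. \<sigma> x * \<Gamma> (g k) (g k) x \<partial>lborel)
        \<le> (\<integral>x. 16 * (exp 1)\<^sup>2 * b * ?h\<^sup>2 * inverse (P x) ^ N \<partial>lborel)"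
    proof (rule integral_mono_AE)
      show "integrable lborel (\<lambda>x. \<sigma> x * \<Gamma> (g k) (g k) x)" by (intro \<Gamma>_integrable_weighted g_Cc \<sigma>)
      show "integrable lborel (\<lambda>x. 16 * (exp 1)\<^sup>2 * b * ?h\<^sup>2 * inverse (P x) ^ N)" using w_int by simp
      show "AE x in lborel. \<sigma> x * \<Gamma> (g k) (g k) x \<le> 16 * (exp 1)\<^sup>2 * b * ?h\<^sup>2 * inverse (P x) ^ N"
        using P(3)
      proof eventually_elim
        case (elim x)
        define d where "d = flat [:0,0,1:] (1 - P x * ?h)"
        have "((\<lambda>y. flat 1 (1 - y * ?h)) has_real_derivative d * (- ?h)) (at (P x))"
          unfolding d_def
          by (rule DERIV_chain2[OF flat_1_has_derivative]) (auto intro!: derivative_eq_intros)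
        then have D: "((\<lambda>y. exp 1 * flat 1 (1 - y * ?h)) has_real_derivative exp 1 * (d * (- ?h))) (at (P x))"
          by (rule DERIV_cmult)
        have "\<Gamma> (g k) (g k) x = (exp 1 * (d * (- ?h)))\<^sup>2 * \<Gamma> P P x"
          using \<Gamma>_compose[OF P(1) D] by (simp add: g_def[abs_def])
        also have "\<dots> \<le> (exp 1 * (d * (- ?h)))\<^sup>2 * (b * (P x)\<^sup>2)"
          using elim by (intro mult_left_mono) auto
        also have "\<dots> = d\<^sup>2 * ((exp 1)\<^sup>2 * ?h\<^sup>2 * b * (P x)\<^sup>2)"
          unfolding power_mult_distrib power2_minus by (simp only: ac_simps)
        also have "\<dots> \<le> 16 * ((exp 1)\<^sup>2 * ?h\<^sup>2 * b * (P x)\<^sup>2)"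
        proof (rule mult_right_mono)
          have "\<bar>d\<bar>\<^sup>2 \<le> 4\<^sup>2" unfolding d_def using flat_deriv_bound by (intro power_mono) auto
          then show "d\<^sup>2 \<le> 16" by simp
        qed (use b in auto)
        finally have "\<sigma> x * \<Gamma> (g k) (g k) x \<le> \<sigma> x * (16 * ((exp 1)\<^sup>2 * ?h\<^sup>2 * b * (P x)\<^sup>2))"
          using \<sigma>(2)[of x] by (intro mult_left_mono) auto
        also have "\<dots> = 16 * (exp 1)\<^sup>2 * b * ?h\<^sup>2 * (inverse (P x) ^ N * (inverse (P x) * P x)\<^sup>2)"
          unfolding \<sigma>_def power_add power_mult_distrib by (simp only: ac_simps)
        finally show ?case using Pnz[of x] by simp
      qed
    qed
    also have "\<dots> = B * ?h\<^sup>2" using w_int by (simp add: B_def)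
    finally show ?thesis .
  qed
  have StL: "S t (g k) \<in> L2" for k using S Cc_inf_L2[OF g_Cc] t by (auto simp: is_semigroup_of_def)
  \<comment> \<open>\<open>u\<close> measures the distance of S_t g_k from 1 and is at most 2
    \<open>E\<close> + 2 \<open>F\<close>: \<open>E\<close> is controlled by the semigroup estimate,
    \<open>F\<close> by dominated convergence of the cutoffs with majorant \<sigma>.\<close>
  define E where "E k x = \<sigma> x * (S t (g k) x - g k x)\<^sup>2" for k x
  define F where "F k x = \<sigma> x * (g k x - 1)\<^sup>2" for k x
  define u where "u k x = \<sigma> x * (S t (g k) x - 1)\<^sup>2" for k x
  have E_int: "integrable lborel (E k)" for k
  proof -
    have z: "(\<lambda>x. S t (g k) x - g k x) \<in> L2" by (intro L2_diff StL Cc_inf_L2 g_Cc)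
    have "\<bar>\<sigma> x\<bar> \<le> 1" for x using \<sigma>(2,3)[of x] by simp
    from L2_integrable_mult[OF L2_bounded_mult[OF z smooth_measurable[OF \<sigma>(1)] this] z]
    show ?thesis by (simp add: E_def[abs_def] power2_eq_square mult.assoc)
  qed
  have F_le: "F k x \<le> \<sigma> x" "0 \<le> F k x" for k x
  proof -
    have "\<bar>g k x - 1\<bar>\<^sup>2 \<le> 1\<^sup>2" using g_nonneg[of k x] g_le_1[of k x] by (intro power_mono) auto
    then show "F k x \<le> \<sigma> x" unfolding F_def using \<sigma>(2)[of x] by (intro mult_left_le) auto
    show "0 \<le> F k x" unfolding F_def using \<sigma>(2)[of x] by simp
  qed
  have F_meas: "F k \<in> borel_measurable borel" for k
    unfolding F_def[abs_def] using smooth_measurable[OF \<sigma>(1)] smooth_measurable[OF g_smooth] by simp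
  have F_int: "integrable lborel (F k)" for k
    by (rule Bochner_Integration.integrable_bound[OF \<sigma>_int])
       (use F_le F_meas \<sigma>(2) in \<open>auto simp: abs_of_pos abs_of_nonneg intro!: AE_I2\<close>)
  have u_le: "u k x \<le> 2 * E k x + 2 * F k x" for k x
  proof -
    have "(S t (g k) x - 1)\<^sup>2 \<le> 2 * (S t (g k) x - g k x)\<^sup>2 + 2 * (g k x - 1)\<^sup>2"
      using zero_le_power2[of "(S t (g k) x - g k x) - (g k x - 1)"] by (simp add: power2_eq_square algebra_simps)
    from mult_left_mono[OF this, of "\<sigma> x"] \<sigma>(2)[of x] show ?thesis
      by (simp add: u_def E_def F_def algebra_simps)
  qed
  have u_nonneg: "0 \<le> u k x" for k x unfolding u_def using \<sigma>(2)[of x] by simp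
  have u_int: "integrable lborel (u k)" for k
  proof (rule Bochner_Integration.integrable_bound)
    show "integrable lborel (\<lambda>x. 2 * E k x + 2 * F k x)" using E_int F_int by simp
    show "u k \<in> borel_measurable lborel"
      unfolding u_def[abs_def] using smooth_measurable[OF \<sigma>(1)] L2_measurable[OF StL] by simp
    show "AE x in lborel. norm (u k x) \<le> norm (2 * E k x + 2 * F k x)"
      using u_le u_nonneg by (intro AE_I2) (metis abs_ge_self abs_of_nonneg order_trans real_norm_def)
  qed
  have "(\<lambda>k. \<integral>x. E k x \<partial>lborel) \<longlonglongrightarrow> 0"
  proof (rule tendsto_sandwich[OF _ _ tendsto_const])
    let ?m = "\<lambda>k. exp (4 * c * t) * (4 * t * (B * (inverse (real (Suc k)))\<^sup>2))"
    have "(\<integral>x. E k x \<partial>lborel) \<le> ?m k" for k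
    proof -
      have "(\<integral>x. E k x \<partial>lborel) \<le> exp (4 * c * t) * (4 * t * (\<integral>x. \<sigma> x * \<Gamma> (g k) (g k) x \<partial>lborel))"
        unfolding E_def by (rule semigroup_weighted_deviation[OF S g_Cc less_imp_le[OF t] \<sigma> \<Gamma>\<sigma> c])
      also have "\<dots> \<le> ?m k" using energy t by (intro mult_left_mono) auto
      finally show ?thesis .
    qed
    then show "\<forall>\<^sub>F k in sequentially. (\<integral>x. E k x \<partial>lborel) \<le> ?m k" by simp
    have "?m \<longlonglongrightarrow> exp (4 * c * t) * (4 * t * (B * 0\<^sup>2))"
      by (intro tendsto_intros LIMSEQ_inverse_real_of_nat)
    then show "?m \<longlonglongrightarrow> 0" by simp
    show "\<forall>\<^sub>F k in sequentially. 0 \<le> (\<integral>x. E k x \<partial>lborel)"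
      using \<sigma>(2) by (intro always_eventually allI integral_nonneg_AE AE_I2) (simp add: E_def less_imp_le)
  qed
  moreover have "(\<lambda>k. \<integral>x. F k x \<partial>lborel) \<longlonglongrightarrow> integral\<^sup>L lborel (\<lambda>x::real^'k. 0)"
  proof (rule integral_dominated_convergence[where w=\<sigma>])
    have "(\<lambda>k. F k x) \<longlonglongrightarrow> \<sigma> x * (1 - 1)\<^sup>2" for x unfolding F_def by (intro tendsto_intros g_lim)
    then show "AE x in lborel. (\<lambda>k. F k x) \<longlonglongrightarrow> 0" by simp
  qed (use F_le F_meas \<sigma>_int in auto)
  ultimately have EF: "(\<lambda>k. 2 * (\<integral>x. E k x \<partial>lborel) + 2 * (\<integral>x. F k x \<partial>lborel)) \<longlonglongrightarrow> 0"
    using tendsto_add[OF tendsto_mult_right_zero tendsto_mult_right_zero] by fastforce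
  have "(\<lambda>k. \<integral>x. norm (u k x) \<partial>lborel) \<longlonglongrightarrow> 0"
  proof (rule tendsto_sandwich[OF _ _ tendsto_const EF])
    have "(\<integral>x. norm (u k x) \<partial>lborel) \<le> (\<integral>x. 2 * E k x + 2 * F k x \<partial>lborel)" for k
      using u_le u_nonneg u_int E_int F_int by (intro integral_mono) auto
    then show "\<forall>\<^sub>F k in sequentially. (\<integral>x. norm (u k x) \<partial>lborel) \<le> 2 * (\<integral>x. E k x \<partial>lborel) + 2 * (\<integral>x. F k x \<partial>lborel)"
      using E_int F_int by simp
  qed auto
  then obtain r where r: "strict_mono r" and ae: "AE x in lborel. (\<lambda>n. u (r n) x) \<longlonglongrightarrow> 0"
    using tendsto_L1_AE_subseq[of lborel u, OF u_int] by blast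
  \<comment> \<open>The kernel identity has its own null set for each cutoff; countably many cutoffs
    leave one common null set.\<close>
  have "AE x in lborel. \<forall>k. S t (g k) x = (\<integral>y. K x y * g k y \<partial>lborel)"
    unfolding AE_all_countable using K_kernel[OF Cc_inf_L2[OF g_Cc]] by blast
  with ae show ?thesis
  proof eventually_elim
    case (elim x)
    have "(\<lambda>n. u (r n) x / \<sigma> x) \<longlonglongrightarrow> 0" using elim(1) by (rule tendsto_divide_zero)
    then have "(\<lambda>n. (S t (g (r n)) x - 1)\<^sup>2) \<longlonglongrightarrow> 0" using \<sigma>(2)[of x] by (simp add: u_def)
    then have "(\<lambda>n. S t (g (r n)) x - 1) \<longlonglongrightarrow> 0" by simp
    then have "(\<lambda>n. \<integral>y. K x y * g (r n) y \<partial>lborel) \<longlonglongrightarrow> 1"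
      using elim(2) by (simp add: LIM_zero_iff)
    moreover have "K x \<in> borel_measurable lborel"
      using measurable_compose[OF measurable_Pair1'[of x lborel lborel] K_meas] by simp
    ultimately show ?case
      using smooth_measurable[OF g_smooth]
      by (intro kernel_mass_eq_1[OF _ _ K_nonneg g_nonneg g_mono g_lim r]) auto
  qed
qed

end

section \<open>Grushin operators\<close>

text \<open>For r <= 1 the power is at most 1, and for r > 1 the exponent may be raised to 2 n. It
  is used with n = 1 for \<open>c1\<close>, where \<delta>1' < 1 enters, and with the large n for
  \<open>c2\<close>.\<close>

lemma pow2_upper:
  assumes "0 < r" "0 \<le> \<alpha>" "\<beta> \<le> real n"
  shows "pow2 r (2 * \<alpha>) (2 * \<beta>) \<le> (1 + r\<^sup>2) ^ n"
proof (cases "r \<le> 1")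
  case True
  have "r powr (2 * \<alpha>) \<le> 1" using True assms by (intro powr_le1) auto
  also have "1 \<le> (1 + r\<^sup>2) ^ n" by (intro one_le_power) simp
  finally show ?thesis using True by (simp add: pow2_def)
next
  case False
  have "r powr (2 * \<beta>) \<le> r powr (real (2 * n))" using False assms by (intro powr_mono) auto
  also have "\<dots> = (r\<^sup>2) ^ n" using assms by (simp add: powr_realpow power_mult del: of_nat_mult)
  also have "\<dots> \<le> (1 + r\<^sup>2) ^ n" by (intro power_mono) auto
  finally show ?thesis using False by (simp add: pow2_def)
qed

text \<open>The quotient r^2 / (1 + r^2) lies below 1 and below r^2, so a high power of it stays
  below r^(2 \<alpha>) for r <= 1 and below 1 beyond. It is rational in r^2, hence smooth in x1 even
  at the origin, and the outer square leaves a smooth root, which up to a constant becomes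
  \<theta>.\<close>

lemma pow2_lower:
  assumes "0 < r" "\<alpha> \<le> real n" "0 \<le> \<beta>"
  shows "((r\<^sup>2 * inverse (1 + r\<^sup>2)) ^ n)\<^sup>2 \<le> pow2 r (2 * \<alpha>) (2 * \<beta>)"
proof -
  let ?y = "r\<^sup>2 * inverse (1 + r\<^sup>2)"
  have p: "0 < 1 + r\<^sup>2" by (intro add_pos_nonneg) auto
  have y: "0 \<le> ?y" "?y \<le> 1" "?y \<le> r\<^sup>2"
    using p by (auto simp: field_simps add_pos_nonneg)
  have y1: "?y ^ n \<le> 1" "0 \<le> ?y ^ n" using y by (auto intro: power_le_one zero_le_power)
  show ?thesis
  proof (cases "r \<le> 1")
    case True
    have "(?y ^ n)\<^sup>2 \<le> ?y ^ n" using y1 by (simp add: power2_eq_square mult_left_le)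
    also have "\<dots> \<le> (r\<^sup>2) ^ n" using y by (intro power_mono) auto
    also have "\<dots> = r powr (real (2 * n))" using assms by (simp add: powr_realpow power_mult del: of_nat_mult)
    also have "\<dots> \<le> r powr (2 * \<alpha>)" using True assms by (intro powr_mono') auto
    finally show ?thesis using True by (simp add: pow2_def)
  next
    case False
    have "(?y ^ n)\<^sup>2 \<le> 1" using y1 by (simp add: power_le_one)
    also have "\<dots> \<le> r powr (2 * \<beta>)" using False assms by (intro ge_one_powr_ge_zero) auto
    finally show ?thesis using False by (simp add: pow2_def)
  qed
qed

section \<open>Calculus in the two blocks of coordinates\<close>

lemma sum_UNIV_sum_type:
  "(\<Sum>i\<in>(UNIV :: ('n::finite + 'm::finite) set). f i) = (\<Sum>i\<in>UNIV. f (Inl i)) + (\<Sum>j\<in>UNIV. f (Inr j))"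
  by (simp add: sum.Plus flip: UNIV_Plus_UNIV)

lemma norm_parts_sq:
  fixes x :: "real^('n::finite + 'm::finite)"
  shows "(norm (fst_part x))\<^sup>2 = (\<Sum>i\<in>UNIV. (x $ Inl i)\<^sup>2)" "(norm (snd_part x))\<^sup>2 = (\<Sum>j\<in>UNIV. (x $ Inr j)\<^sup>2)"
    "x \<bullet> x = (norm (fst_part x))\<^sup>2 + (norm (snd_part x))\<^sup>2"
  unfolding power2_norm_eq_inner
  by (simp_all add: inner_vec_def fst_part_def snd_part_def sum_UNIV_sum_type power2_eq_square)

text \<open>A vanishing first block puts x into a coordinate hyperplane, which is null; the block
  has at least one coordinate because types are nonempty.\<close>

lemma AE_fst_part_nonzero: "AE x in lborel. fst_part (x :: real^('n::finite + 'm::finite)) \<noteq> 0"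
proof -
  fix i :: 'n
  have "negligible {x :: real^('n + 'm). x $ Inl i = 0}"
    by (rule negligible_standard_hyperplane_cart)
  moreover have "{x :: real^('n + 'm). x $ Inl i = 0} \<in> sets borel"
    by (intro borel_closed closed_Collect_eq continuous_intros)
  ultimately have "{x :: real^('n + 'm). x $ Inl i = 0} \<in> null_sets lborel"
    by (simp add: negligible_iff_null_sets null_sets_completion_iff)
  then show ?thesis
    by (rule AE_I') (auto simp: fst_part_def vec_eq_iff)
qed

lemma smooth_norm_parts:
  "smooth (\<lambda>x::real^('n::finite + 'm::finite). (norm (fst_part x))\<^sup>2)"
  "smooth (\<lambda>x::real^('n::finite + 'm::finite). (norm (snd_part x))\<^sup>2)"
  unfolding norm_parts_sq by (intro smooth_sum smooth_power smooth_nth)+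

lemma partial_nth: "partial k (\<lambda>x::real^'k::finite. x $ i) x = (if i = k then 1 else 0)"
  unfolding partial_def
  by (subst frechet_derivative_eq[OF bounded_linear_imp_has_derivative[OF bounded_linear_vec_nth]])
     (simp add: axis_def)

lemma partial_sum:
  assumes "\<And>i. i \<in> A \<Longrightarrow> smooth (f i)"
  shows "partial k (\<lambda>x. \<Sum>i\<in>A. f i x) x = (\<Sum>i\<in>A. partial k (f i) x)"
  using assms
  by (induction A rule: infinite_finite_induct) (auto simp: partial_const partial_add smooth_sum)

lemma partial_nth_sq: "partial k (\<lambda>x::real^'k::finite. (x $ i)\<^sup>2) x = (if i = k then 2 * x $ k else 0)"
  using partial_mult[OF smooth_nth smooth_nth, of k i i x] by (simp add: power2_eq_square partial_nth)

lemma grad_norm_parts: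
  fixes x :: "real^('n::finite + 'm::finite)"
  shows "fst_part (grad (\<lambda>x. (norm (fst_part x))\<^sup>2) x) = 2 *\<^sub>R fst_part x"
    and "snd_part (grad (\<lambda>x::real^('n + 'm). (norm (fst_part x))\<^sup>2) x) = 0"
    and "fst_part (grad (\<lambda>x::real^('n + 'm). (norm (snd_part x))\<^sup>2) x) = 0"
    and "snd_part (grad (\<lambda>x. (norm (snd_part x))\<^sup>2) x) = 2 *\<^sub>R snd_part x"
  unfolding norm_parts_sq
  by (simp_all add: vec_eq_iff fst_part_def snd_part_def grad_def partial_sum smooth_power smooth_nth
        partial_nth_sq)

lemma parts_linear:
  "fst_part (x + y) = fst_part x + fst_part y" "fst_part (c *\<^sub>R x) = c *\<^sub>R fst_part x"
  "snd_part (x + y) = snd_part x + snd_part y" "snd_part (c *\<^sub>R x) = c *\<^sub>R snd_part x"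
  by (simp_all add: fst_part_def snd_part_def vec_eq_iff)

text \<open>On bounded functions the semigroup acts through its kernel, so S_t 1 = 1 is read as unit
  mass of \<open>K t x\<close>. The nonnegative integral gives this a meaning without presupposing
  integrability.\<close>

theorem theorem6p1:
  fixes C :: "real^('n::finite + 'm::finite) \<Rightarrow> real^('n + 'm)^('n + 'm)"
    and c1 :: "real^'n \<Rightarrow> real" and c2 :: "real^'n \<Rightarrow> real"
    and \<delta>1 \<delta>1' \<delta>2 \<delta>2' :: real
    and S :: "real \<Rightarrow> (real^('n + 'm) \<Rightarrow> real) \<Rightarrow> (real^('n + 'm) \<Rightarrow> real)"
    and K :: "real \<Rightarrow> real^('n + 'm) \<Rightarrow> real^('n + 'm) \<Rightarrow> real"
  assumes d1: "0 \<le> \<delta>1" "\<delta>1 < 1" "0 \<le> \<delta>1'" "\<delta>1' < 1"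
    and d2: "0 \<le> \<delta>2" "0 \<le> \<delta>2'"
    and C_meas: "\<And>i j. (\<lambda>x. C x $ i $ j) \<in> borel_measurable lborel"
    and C_sym: "\<And>x. transpose (C x) = C x"
    and C_pos: "AE x in lborel. \<forall>\<xi>. \<xi> \<noteq> 0 \<longrightarrow> \<xi> \<bullet> (C x *v \<xi>) > 0"
    and c1_equiv: "\<exists>a b. 0 < a \<and> 0 < b \<and> (\<forall>y. y \<noteq> 0 \<longrightarrow>
          a * pow2 (norm y) (2 * \<delta>1) (2 * \<delta>1') \<le> c1 y \<and>
          c1 y \<le> b * pow2 (norm y) (2 * \<delta>1) (2 * \<delta>1'))"
    and c2_equiv: "\<exists>a b. 0 < a \<and> 0 < b \<and> (\<forall>y. y \<noteq> 0 \<longrightarrow>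
          a * pow2 (norm y) (2 * \<delta>2) (2 * \<delta>2') \<le> c2 y \<and>
          c2 y \<le> b * pow2 (norm y) (2 * \<delta>2) (2 * \<delta>2'))"
    and C_equiv: "\<exists>a b. 0 < a \<and> 0 < b \<and> (AE x in lborel. \<forall>\<xi>.
          a * (c1 (fst_part x) * (norm (fst_part \<xi>))^2 + c2 (fst_part x) * (norm (snd_part \<xi>))^2)
            \<le> \<xi> \<bullet> (C x *v \<xi>) \<and>
          \<xi> \<bullet> (C x *v \<xi>)
            \<le> b * (c1 (fst_part x) * (norm (fst_part \<xi>))^2 + c2 (fst_part x) * (norm (snd_part \<xi>))^2))"
    and S_def: "is_semigroup_of C S"
    and K_nonneg: "\<And>t x y. 0 \<le> K t x y"
    and K_meas: "\<And>t. t > 0 \<Longrightarrow> (\<lambda>(x, y). K t x y) \<in> borel_measurable (lborel \<Otimes>\<^sub>M lborel)"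
    and K_kernel: "\<And>t \<phi>. t > 0 \<Longrightarrow> \<phi> \<in> L2 \<Longrightarrow>
          AE x in lborel. S t \<phi> x = (\<integral>y. K t x y * \<phi> y \<partial>lborel)"
  shows "\<forall>t>0. AE x in lborel. (\<integral>\<^sup>+ y. ennreal (K t x y) \<partial>lborel) = 1"
proof -
  obtain a1 b1 where ab1: "0 < a1" "0 < b1"
    "\<And>y. y \<noteq> 0 \<Longrightarrow> a1 * pow2 (norm y) (2 * \<delta>1) (2 * \<delta>1') \<le> c1 y \<and> c1 y \<le> b1 * pow2 (norm y) (2 * \<delta>1) (2 * \<delta>1')"
    using c1_equiv by blast
  obtain a2 b2 where ab2: "0 < a2" "0 < b2"
    "\<And>y. y \<noteq> 0 \<Longrightarrow> a2 * pow2 (norm y) (2 * \<delta>2) (2 * \<delta>2') \<le> c2 y \<and> c2 y \<le> b2 * pow2 (norm y) (2 * \<delta>2) (2 * \<delta>2')"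
    using c2_equiv by blast
  obtain a b where ab: "0 < a" "0 < b"
    and C_ab: "AE x in lborel. \<forall>\<xi>.
          a * (c1 (fst_part x) * (norm (fst_part \<xi>))^2 + c2 (fst_part x) * (norm (snd_part \<xi>))^2)
            \<le> \<xi> \<bullet> (C x *v \<xi>) \<and>
          \<xi> \<bullet> (C x *v \<xi>)
            \<le> b * (c1 (fst_part x) * (norm (fst_part \<xi>))^2 + c2 (fst_part x) * (norm (snd_part \<xi>))^2)"
    using C_equiv by blast
  \<comment> \<open>\<open>n\<close> below is the power \<kappa> in P. It exceeds \<delta>2 and
    \<delta>2'; being \<open>Suc n0\<close> it is at least 1, which places it above \<delta>1 and
    gives \<rho> <= \<rho>^n.\<close>
  obtain n0 where n0: "max \<delta>2 \<delta>2' \<le> real n0" using real_arch_simple by blast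
  define n where "n = Suc n0"
  have n: "\<delta>1 \<le> real n" "\<delta>2 \<le> real n" "\<delta>2' \<le> real n" using n0 d1 by (auto simp: n_def)
  define \<rho> :: "real^('n + 'm) \<Rightarrow> real" where "\<rho> x = 1 + (norm (fst_part x))\<^sup>2" for x
  have \<rho>1: "1 \<le> \<rho> x" for x by (simp add: \<rho>_def)
  have \<rho>_nz: "\<rho> x \<noteq> 0" for x using \<rho>1[of x] by linarith
  have \<rho>_smooth: "smooth \<rho>" unfolding \<rho>_def[abs_def] by (intro smooth_add smooth_const smooth_norm_parts)
  have \<rho>_n: "\<rho> x \<le> \<rho> x ^ n" for x using \<rho>1[of x] power_increasing[of 1 n "\<rho> x"] by (simp add: n_def)
  define m where "m = min (a * a1) (a * a2)"
  have m: "0 < m" using ab ab1 ab2 by (simp add: m_def)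
  define B where "B = b * b1 + b * b2"
  have B: "0 < B" "b * b1 \<le> B" "b * b2 \<le> B" using ab ab1 ab2 by (auto simp: B_def add_pos_pos)
  define \<theta> where "\<theta> x = sqrt m * ((norm (fst_part x))\<^sup>2 * inverse (\<rho> x)) ^ n" for x :: "real^('n + 'm)"
  \<comment> \<open>The upper bound keeps \<rho> in the x1 directions and \<rho>^n in the x2
    directions. The cruder B \<rho>^n is enough for integrability, but multiplied with the x1
    gradient of P it would in general exceed P^2.\<close>
  have bounds: "AE x in lborel. \<forall>\<xi>. (\<theta> x)\<^sup>2 * (\<xi> \<bullet> \<xi>) \<le> \<xi> \<bullet> (C x *v \<xi>) \<and>
     \<xi> \<bullet> (C x *v \<xi>) \<le> B * (\<rho> x * (norm (fst_part \<xi>))\<^sup>2 + \<rho> x ^ n * (norm (snd_part \<xi>))\<^sup>2)"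
    using C_ab AE_fst_part_nonzero
  proof eventually_elim
    case (elim x)
    define r where "r = norm (fst_part x)"
    have r: "r > 0" using elim by (simp add: r_def)
    define p1 where "p1 = pow2 r (2 * \<delta>1) (2 * \<delta>1')"
    define p2 where "p2 = pow2 r (2 * \<delta>2) (2 * \<delta>2')"
    define w where "w = ((r\<^sup>2 * inverse (1 + r\<^sup>2)) ^ n)\<^sup>2"
    have w: "w \<le> p1" "w \<le> p2" "0 \<le> w"
      unfolding w_def p1_def p2_def using r n d1 d2 by (auto intro: pow2_lower)
    have \<theta>w: "(\<theta> x)\<^sup>2 = m * w" using m by (simp add: \<theta>_def w_def r_def \<rho>_def power_mult_distrib)
    have up: "p1 \<le> \<rho> x" "p2 \<le> \<rho> x ^ n"
      using pow2_upper[of r \<delta>1 \<delta>1' 1] pow2_upper[of r \<delta>2 \<delta>2' n] r n d1 d2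
      by (auto simp: p1_def p2_def \<rho>_def r_def)
    have c1: "a1 * p1 \<le> c1 (fst_part x)" "c1 (fst_part x) \<le> b1 * p1"
      using ab1(3)[OF elim(2)] by (auto simp: p1_def r_def)
    have c2: "a2 * p2 \<le> c2 (fst_part x)" "c2 (fst_part x) \<le> b2 * p2"
      using ab2(3)[OF elim(2)] by (auto simp: p2_def r_def)
    have lo: "m * w \<le> a * c1 (fst_part x)" "m * w \<le> a * c2 (fst_part x)"
    proof -
      have "m * w \<le> (a * a1) * p1" using w m ab ab1 by (intro mult_mono) (auto simp: m_def)
      also have "\<dots> \<le> a * c1 (fst_part x)" using c1 ab by (simp add: mult.assoc)
      finally show "m * w \<le> a * c1 (fst_part x)" .
      have "m * w \<le> (a * a2) * p2" using w m ab ab2 by (intro mult_mono) (auto simp: m_def)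
      also have "\<dots> \<le> a * c2 (fst_part x)" using c2 ab by (simp add: mult.assoc)
      finally show "m * w \<le> a * c2 (fst_part x)" .
    qed
    have hi: "b * c1 (fst_part x) \<le> B * \<rho> x" "b * c2 (fst_part x) \<le> B * \<rho> x ^ n"
    proof -
      have "b * c1 (fst_part x) \<le> (b * b1) * p1" using c1 ab by (simp add: mult.assoc)
      also have "\<dots> \<le> B * \<rho> x" using B up w by (intro mult_mono) auto
      finally show "b * c1 (fst_part x) \<le> B * \<rho> x" .
      have "b * c2 (fst_part x) \<le> (b * b2) * p2" using c2 ab by (simp add: mult.assoc)
      also have "\<dots> \<le> B * \<rho> x ^ n" using B up w by (intro mult_mono) auto
      finally show "b * c2 (fst_part x) \<le> B * \<rho> x ^ n" .
    qed
    show ?case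
    proof (intro allI conjI)
      fix \<xi> :: "real^('n + 'm)"
      have "(\<theta> x)\<^sup>2 * (\<xi> \<bullet> \<xi>) = (m * w) * (norm (fst_part \<xi>))\<^sup>2 + (m * w) * (norm (snd_part \<xi>))\<^sup>2"
        by (simp add: \<theta>w norm_parts_sq(3) distrib_left)
      also have "\<dots> \<le> (a * c1 (fst_part x)) * (norm (fst_part \<xi>))\<^sup>2 + (a * c2 (fst_part x)) * (norm (snd_part \<xi>))\<^sup>2"
        using lo by (intro add_mono mult_right_mono) auto
      also have "\<dots> \<le> \<xi> \<bullet> (C x *v \<xi>)" using elim(1) by (simp add: distrib_left mult.assoc)
      finally show "(\<theta> x)\<^sup>2 * (\<xi> \<bullet> \<xi>) \<le> \<xi> \<bullet> (C x *v \<xi>)" .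
      have "\<xi> \<bullet> (C x *v \<xi>) \<le> (b * c1 (fst_part x)) * (norm (fst_part \<xi>))\<^sup>2 + (b * c2 (fst_part x)) * (norm (snd_part \<xi>))\<^sup>2"
        using elim(1) by (simp add: distrib_left mult.assoc)
      also have "\<dots> \<le> (B * \<rho> x) * (norm (fst_part \<xi>))\<^sup>2 + (B * \<rho> x ^ n) * (norm (snd_part \<xi>))\<^sup>2"
        using hi by (intro add_mono mult_right_mono) auto
      finally show "\<xi> \<bullet> (C x *v \<xi>) \<le> B * (\<rho> x * (norm (fst_part \<xi>))\<^sup>2 + \<rho> x ^ n * (norm (snd_part \<xi>))\<^sup>2)"
        by (simp add: distrib_left mult.assoc)
    qed
  qed
  interpret degenerate_form C \<theta> "\<lambda>x. B * \<rho> x ^ n"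
  proof
    show "(\<lambda>x. C x $ i $ j) \<in> borel_measurable borel" for i j using C_meas[of i j] by simp
    show "transpose (C x) = C x" for x by (rule C_sym)
    show "smooth \<theta>" unfolding \<theta>_def[abs_def]
      by (intro smooth_mult smooth_const smooth_power smooth_norm_parts smooth_inverse \<rho>_smooth \<rho>_nz)
    show "AE x in lborel. \<theta> x \<noteq> 0" using AE_fst_part_nonzero
    proof eventually_elim
      case (elim x)
      then show ?case using m \<rho>1[of x] by (auto simp: \<theta>_def)
    qed
    show "continuous_on UNIV (\<lambda>x. B * \<rho> x ^ n)"
      by (intro smooth_continuous smooth_mult smooth_const smooth_power \<rho>_smooth)
    show "AE x in lborel. \<forall>\<xi>. (\<theta> x)\<^sup>2 * (\<xi> \<bullet> \<xi>) \<le> \<xi> \<bullet> (C x *v \<xi>)"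
      using bounds by eventually_elim blast
    show "AE x in lborel. \<forall>\<xi>. \<xi> \<bullet> (C x *v \<xi>) \<le> B * \<rho> x ^ n * (\<xi> \<bullet> \<xi>)"
      using bounds
    proof eventually_elim
      case (elim x)
      show ?case
      proof
        fix \<xi> :: "real^('n + 'm)"
        have "\<rho> x * (norm (fst_part \<xi>))\<^sup>2 \<le> \<rho> x ^ n * (norm (fst_part \<xi>))\<^sup>2"
          using \<rho>_n by (intro mult_right_mono) auto
        then have "B * (\<rho> x * (norm (fst_part \<xi>))\<^sup>2 + \<rho> x ^ n * (norm (snd_part \<xi>))\<^sup>2) \<le> B * (\<rho> x ^ n * (\<xi> \<bullet> \<xi>))"
          using B(1) by (intro mult_left_mono) (auto simp: norm_parts_sq(3) distrib_left)
        then show "\<xi> \<bullet> (C x *v \<xi>) \<le> B * \<rho> x ^ n * (\<xi> \<bullet> \<xi>)"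
          using elim[rule_format, of \<xi>] by (simp add: mult.assoc)
      qed
    qed
  qed
  define P where "P x = \<rho> x ^ n + (norm (snd_part x))\<^sup>2" for x :: "real^('n + 'm)"
  have P_smooth: "smooth P" unfolding P_def[abs_def]
    by (intro smooth_add smooth_power \<rho>_smooth smooth_norm_parts)
  have P_lower: "1 + x \<bullet> x \<le> P x" for x
    using \<rho>_n[of x] by (simp add: P_def \<rho>_def norm_parts_sq(3))
  have P_energy: "AE x in lborel. \<Gamma> P P x \<le> (B * (4 * (real n)\<^sup>2 + 4)) * (P x)\<^sup>2"
    using bounds
  proof eventually_elim
    case (elim x)
    let ?d = "real n * \<rho> x ^ n0"
    have "((\<lambda>y. 1 + y) has_real_derivative 1) (at ((norm (fst_part x))\<^sup>2))"
      by (auto intro!: derivative_eq_intros)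
    from DERIV_power_Suc[OF this, of n0]
    have "((\<lambda>y. (1 + y) ^ n) has_real_derivative ?d) (at ((norm (fst_part x))\<^sup>2))"
      by (simp add: n_def \<rho>_def)
    from grad_compose[where f="\<lambda>x. (norm (fst_part x))\<^sup>2", OF smooth_norm_parts(1) this]
    have "grad (\<lambda>x. \<rho> x ^ n) x = ?d *\<^sub>R grad (\<lambda>x. (norm (fst_part x))\<^sup>2) x"
      by (simp add: \<rho>_def[abs_def])
    then have "grad P x = ?d *\<^sub>R grad (\<lambda>x. (norm (fst_part x))\<^sup>2) x + grad (\<lambda>x. (norm (snd_part x))\<^sup>2) x"
      unfolding P_def[abs_def] by (simp add: grad_add smooth_power \<rho>_smooth smooth_norm_parts)
    then have parts: "fst_part (grad P x) = (?d * 2) *\<^sub>R fst_part x" "snd_part (grad P x) = 2 *\<^sub>R snd_part x"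
      by (simp_all add: parts_linear grad_norm_parts)
    have s: "(norm (fst_part x))\<^sup>2 \<le> \<rho> x" by (simp add: \<rho>_def)
    have rP: "\<rho> x ^ n \<le> P x" "(norm (snd_part x))\<^sup>2 \<le> P x" "0 \<le> \<rho> x ^ n" "0 \<le> P x"
      using \<rho>1[of x] by (auto simp: P_def)
    \<comment> \<open>One factor \<rho> from the coefficient and one from |x1|^2 raise \<rho>^(2 n0)
      to \<rho>^(2 n), which is at most P^2.\<close>
    have "\<rho> x * (norm (fst_part (grad P x)))\<^sup>2 = 4 * (real n)\<^sup>2 * (\<rho> x ^ n0)\<^sup>2 * \<rho> x * (norm (fst_part x))\<^sup>2"
      by (simp add: parts power_mult_distrib)
    also have "\<dots> \<le> 4 * (real n)\<^sup>2 * (\<rho> x ^ n0)\<^sup>2 * \<rho> x * \<rho> x"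
      using s \<rho>1[of x] by (intro mult_left_mono) auto
    also have "\<dots> = 4 * (real n)\<^sup>2 * (\<rho> x ^ n)\<^sup>2" by (simp add: n_def power2_eq_square)
    also have "\<dots> \<le> 4 * (real n)\<^sup>2 * (P x)\<^sup>2" using rP by (intro mult_left_mono power_mono) auto
    finally have 1: "\<rho> x * (norm (fst_part (grad P x)))\<^sup>2 \<le> 4 * (real n)\<^sup>2 * (P x)\<^sup>2" .
    \<comment> \<open>Here \<rho>^n and |x2|^2 are the two summands of P, so their product is at
      most P^2.\<close>
    have "\<rho> x ^ n * (norm (snd_part (grad P x)))\<^sup>2 = 4 * (\<rho> x ^ n * (norm (snd_part x))\<^sup>2)"
      by (simp add: parts power_mult_distrib)
    also have "\<dots> \<le> 4 * (P x * P x)" using rP by (intro mult_left_mono mult_mono) auto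
    finally have 2: "\<rho> x ^ n * (norm (snd_part (grad P x)))\<^sup>2 \<le> 4 * (P x)\<^sup>2" by (simp add: power2_eq_square)
    have "\<Gamma> P P x \<le> B * (\<rho> x * (norm (fst_part (grad P x)))\<^sup>2 + \<rho> x ^ n * (norm (snd_part (grad P x)))\<^sup>2)"
      unfolding \<Gamma>_def using elim by blast
    also have "\<dots> \<le> B * (4 * (real n)\<^sup>2 * (P x)\<^sup>2 + 4 * (P x)\<^sup>2)"
      using 1 2 B(1) by (intro mult_left_mono add_mono) auto
    finally show ?case by (simp add: algebra_simps)
  qed
  show ?thesis
  proof (intro allI impI)
    fix t :: real assume t: "t > 0"
    show "AE x in lborel. (\<integral>\<^sup>+ y. ennreal (K t x y) \<partial>lborel) = 1"
      by (rule semigroup_kernel_conservative[OF S_def K_nonneg K_meas[OF t] K_kernel[OF t] t P_smooth P_lower P_energy])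
         (use B(1) in auto)
  qed
qed

end
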